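(* Let $p$ be a fixed prime and let $R$ be a pre-$\psi^p$-algebra. Then there exist operations $$P^i \colon \mathrm{Gr}^*R \otimes \mathbb{Z}/p \to \mathrm{Gr}^{*+2i(p-1)}R \otimes \mathbb{Z}/p \qquad (i \geq 0)$$ defined as follows. Given any element $\overline{r} \in \mathrm{Gr}^{2q}R \otimes \mathbb{Z}/p$, lift it to any element $r \in R$ in filtration exactly $2q$ whose image in $\mathrm{Gr}^{2q}R \otimes \mathbb{Z}/p$ is $\overline{r}$, and write down an Atiyah formula $\psi^p(r) = \sum_{i=0}^q p^{q-i} r_i$ (or, in case $q=0$, $\psi^p(r) = r^p + p r'$) for $r$. Then define $P^i\overline{r} \in \mathrm{Gr}^{2q+2i(p-1)}R \otimes \mathbb{Z}/p$ by $$P^i \overline{r} = \begin{cases} \overline{r}^{\,p} & \text{if } i = q = 0,\\ \overline{r_i} & \text{if } 0 \le i \le q \text{ and } q > 0,\\ 0 & \text{if } i > q \ge 0.\end{cases}$$ Moreover, these operations have the following four properties. 1. Each $P^i$ is additive. 2. For any $q \geq 0$, $P^q$ is the $p$th power map from $\mathrm{Gr}^{2q}R \otimes \mathbb{Z}/p$ to $\mathrm{Gr}^{2pq}R \otimes \mathbb{Z}/p$. 3. If $\overline{r}$ has degree $2q$, then $P^i\overline{r} = 0$ for every $i > q$. 4. For any two elements $\overline{r}$ and $\overline{s}$ in $\mathrm{Gr}^*R \otimes \mathbb{Z}/p$, $P^i(\overline{r}\,\overline{s}) = \sum_{l+k=i} (P^l\overline{r})(P^k\overline{s})$.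
   Context: Tensor products are over $\mathbb{Z}$. A filtered algebra is a commutative ring $R$ with unit together with a multiplicative decreasing filtration by ideals $R = I^0 \supset I^1 \supset I^2 \supset \cdots$ (multiplicative: $I^mI^n \subset I^{m+n}$). An element is in filtration $n$ if it lies in $I^n$. The associated graded algebra is $\mathrm{Gr}^*R = \bigoplus_{n\ge 0} I^n/I^{n+1}$. For $r \in I^n$, $\overline{r}$ denotes its image in $\mathrm{Gr}^nR \otimes \mathbb{Z}/p$, where $n$ is the filtration in which $r$ is considered. A pre-$\psi^p$-algebra is a filtered algebra $R$ with a distinguished ring endomorphism $\psi^p\colon R \to R$ such that: (i) $I^{2n} = I^{2n-1}$ for all $n \ge 1$; (ii) for every $q\ge 0$ and every $r \in I^{2q}$: if $q > 0$, there exist elements $r_i \in I^{2q+2i(p-1)}$ $(0 \le i \le q)$ with $r_q = r^p$ and $\psi^p(r) = p^q r_0 + p^{q-1}r_1 + \cdots + p r_{q-1} + r_q$; if $q = 0$, there exists $r' \in R$ with $\psi^p(r) = p r' + r^p$. Moreover, for $q>0$ the elements $r_i$ are required to be well-defined in the associated graded algebra mod $p$: if $\psi^p(r) = \sum_{i=0}^q p^{q-i} r_i'$ is another such decomposition, then $\overline{r_i} = \overline{r_i'}$ in $\mathrm{Gr}^{2q+2i(p-1)}R \otimes \mathbb{Z}/p$ for all $i$. Any decomposition of $\psi^p(r)$ as in (ii) is called an Atiyah formula for $r$ (in filtration $2q$). An element lying in several filtrations is to satisfy (ii) for each of them. An element $r$ is in filtration exactly $2q$ if $r \in I^{2q}$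 and $r \notin I^{2q+2}$ (where $I^{2q+2} = I^{2q+1}$ by (i)). *)

theory Defs
  imports "HOL-Algebra.Free_Abelian_Groups" "HOL-Algebra.IntRing" "HOL-Algebra.Ideal_Product"
begin

section \<open>Tensor products of rings over the integers\<close>

text \<open>
  The free abelian group on \<open>carrier A \<times> carrier B\<close>, with the product that is biadditive and satisfies
  \<open>(a, b) (c, d) = (a c, b d)\<close> on generators.
\<close>

definition free_pair_ring ::
  "('a, 'm) ring_scheme \<Rightarrow> ('b, 'n) ring_scheme \<Rightarrow> ('a \<times> 'b \<Rightarrow>\<^sub>0 int) ring" where
  "free_pair_ring A B =
    \<lparr> carrier = carrier (free_Abelian_group (carrier A \<times> carrier B)),
      monoid.mult = (\<lambda>f g. frag_extend (\<lambda>(a, b).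
                frag_extend (\<lambda>(c, d). frag_of (a \<otimes>\<^bsub>A\<^esub> c, b \<otimes>\<^bsub>B\<^esub> d)) g) f),
      one = frag_of (\<one>\<^bsub>A\<^esub>, \<one>\<^bsub>B\<^esub>),
      ring.zero = 0,
      ring.add = (+) \<rparr>"

definition tensor_relations ::
  "('a, 'm) ring_scheme \<Rightarrow> ('b, 'n) ring_scheme \<Rightarrow> ('a \<times> 'b \<Rightarrow>\<^sub>0 int) set" where
  "tensor_relations A B =
    {frag_of (a \<oplus>\<^bsub>A\<^esub> a', b) - frag_of (a, b) - frag_of (a', b) | a a' b.
        a \<in> carrier A \<and> a' \<in> carrier A \<and> b \<in> carrier B} \<union>
    {frag_of (a, b \<oplus>\<^bsub>B\<^esub> b') - frag_of (a, b) - frag_of (a, b') | a b b'.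
        a \<in> carrier A \<and> b \<in> carrier B \<and> b' \<in> carrier B}"

text \<open>
  The additive subgroup generated by the biadditivity relations is an ideal of
  \<^term>\<open>free_pair_ring A B\<close>; the quotient group is the tensor product over the integers, and the
  quotient product is the usual one, \<open>(a \<otimes> b) (c \<otimes> d) = a c \<otimes> b d\<close>.
\<close>

definition tensor_kernel ::
  "('a, 'm) ring_scheme \<Rightarrow> ('b, 'n) ring_scheme \<Rightarrow> ('a \<times> 'b \<Rightarrow>\<^sub>0 int) set" where
  "tensor_kernel A B = generate (add_monoid (free_pair_ring A B)) (tensor_relations A B)"

definition tensor_ring ::
  "('a, 'm) ring_scheme \<Rightarrow> ('b, 'n) ring_scheme \<Rightarrow> ('a \<times> 'b \<Rightarrow>\<^sub>0 int) set ring" where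
  "tensor_ring A B = free_pair_ring A B Quot tensor_kernel A B"

definition pure_tensor ::
  "('a, 'm) ring_scheme \<Rightarrow> ('b, 'n) ring_scheme \<Rightarrow> 'a \<Rightarrow> 'b \<Rightarrow> ('a \<times> 'b \<Rightarrow>\<^sub>0 int) set" where
  "pure_tensor A B a b = tensor_kernel A B +>\<^bsub>free_pair_ring A B\<^esub> frag_of (a, b)"

section \<open>Filtered algebras and the associated graded algebra\<close>

locale filtered_algebra = cring R for R (structure) +
  fixes I :: "nat \<Rightarrow> 'a set"
  assumes filtration_ideal: "ideal (I n) R"
    and filtration_zero: "I 0 = carrier R"
    and filtration_decreasing: "I (Suc n) \<subseteq> I n"
    and filtration_multiplicative: "I m \<cdot> I n \<subseteq> I (m + n)"

text \<open>The additive group \<open>I\<^sup>n / I\<^sup>n\<^sup>+\<^sup>1\<close>; as for every factor group of the library, its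
  operation is written multiplicatively.\<close>

definition gr_piece :: "('a, 'm) ring_scheme \<Rightarrow> (nat \<Rightarrow> 'a set) \<Rightarrow> nat \<Rightarrow> 'a set monoid" where
  "gr_piece R I n = (add_monoid R)\<lparr>carrier := I n\<rparr> Mod I (Suc n)"

text \<open>
  The direct sum of the \<open>I\<^sup>n / I\<^sup>n\<^sup>+\<^sup>1\<close>, with the product induced by
  \<open>(a + I\<^sup>k\<^sup>+\<^sup>1) (b + I\<^sup>l\<^sup>+\<^sup>1) = a b + I\<^sup>k\<^sup>+\<^sup>l\<^sup>+\<^sup>1\<close>. The \<^const>\<open>finprod\<close> is a sum in the
  additive group \<^term>\<open>gr_piece R I n\<close>.
\<close>

definition gr_ring :: "('a, 'm) ring_scheme \<Rightarrow> (nat \<Rightarrow> 'a set) \<Rightarrow> (nat \<Rightarrow> 'a set) ring" where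
  "gr_ring R I =
    \<lparr> carrier = carrier (sum_group UNIV (gr_piece R I)),
      monoid.mult = (\<lambda>x y n. finprod (gr_piece R I n)
                (\<lambda>k. rcoset_mult R (I (Suc n)) (x k) (y (n - k))) {..n}),
      one = (\<lambda>n. if n = 0 then I (Suc 0) +>\<^bsub>R\<^esub> \<one>\<^bsub>R\<^esub> else \<one>\<^bsub>gr_piece R I n\<^esub>),
      ring.zero = \<one>\<^bsub>sum_group UNIV (gr_piece R I)\<^esub>,
      ring.add = (\<otimes>\<^bsub>sum_group UNIV (gr_piece R I)\<^esub>) \<rparr>"

definition gr_embed ::
  "('a, 'm) ring_scheme \<Rightarrow> (nat \<Rightarrow> 'a set) \<Rightarrow> nat \<Rightarrow> 'a set \<Rightarrow> nat \<Rightarrow> 'a set" where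
  "gr_embed R I n a = (\<lambda>m. if m = n then a else \<one>\<^bsub>gr_piece R I m\<^esub>)"

type_synonym 'a gr_mod = "((nat \<Rightarrow> 'a set) \<times> int set \<Rightarrow>\<^sub>0 int) set"

definition gr_mod_ring ::
  "nat \<Rightarrow> ('a, 'm) ring_scheme \<Rightarrow> (nat \<Rightarrow> 'a set) \<Rightarrow> 'a gr_mod ring" where
  "gr_mod_ring p R I = tensor_ring (gr_ring R I) (ZFact (int p))"

text \<open>
  The homogeneous part of degree \<open>n\<close>, that is \<open>Gr\<^sup>n R \<otimes> \<int>/p\<close> regarded as a direct summand of
  \<open>Gr\<^sup>* R \<otimes> \<int>/p\<close>.
\<close>

definition gr_mod_piece ::
  "nat \<Rightarrow> ('a, 'm) ring_scheme \<Rightarrow> (nat \<Rightarrow> 'a set) \<Rightarrow> nat \<Rightarrow> 'a gr_mod set" where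
  "gr_mod_piece p R I n = generate (add_monoid (gr_mod_ring p R I))
    {pure_tensor (gr_ring R I) (ZFact (int p)) (gr_embed R I n a) z | a z.
       a \<in> carrier (gr_piece R I n) \<and> z \<in> carrier (ZFact (int p))}"

text \<open>The image \<open>(r + I\<^sup>n\<^sup>+\<^sup>1) \<otimes> 1\<close> in degree \<open>n\<close> of an element \<open>r\<close>, considered in filtration \<open>n\<close>.\<close>

definition gr_mod_class ::
  "nat \<Rightarrow> ('a, 'm) ring_scheme \<Rightarrow> (nat \<Rightarrow> 'a set) \<Rightarrow> nat \<Rightarrow> 'a \<Rightarrow> 'a gr_mod" where
  "gr_mod_class p R I n r = pure_tensor (gr_ring R I) (ZFact (int p))
     (gr_embed R I n (I (Suc n) +>\<^bsub>R\<^esub> r)) \<one>\<^bsub>ZFact (int p)\<^esub>"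

section \<open>Pre-psi-algebras\<close>

text \<open>An Atiyah formula for \<open>r\<close> in filtration \<open>2q\<close>, where \<open>q > 0\<close>; only the values \<open>f 0, \<dots>, f q\<close>
  matter.\<close>

definition atiyah_formula ::
  "nat \<Rightarrow> ('a, 'm) ring_scheme \<Rightarrow> (nat \<Rightarrow> 'a set) \<Rightarrow> ('a \<Rightarrow> 'a) \<Rightarrow> nat \<Rightarrow> 'a \<Rightarrow> (nat \<Rightarrow> 'a) \<Rightarrow> bool" where
  "atiyah_formula p R I \<psi> q r f \<longleftrightarrow>
     (\<forall>i\<le>q. f i \<in> I (2 * q + 2 * i * (p - 1))) \<and>
     f q = r [^]\<^bsub>R\<^esub> p \<and>
     \<psi> r = (\<Oplus>\<^bsub>R\<^esub>i\<in>{..q}. add_pow R (p ^ (q - i)) (f i))"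

definition atiyah_formula_zero ::
  "nat \<Rightarrow> ('a, 'm) ring_scheme \<Rightarrow> ('a \<Rightarrow> 'a) \<Rightarrow> 'a \<Rightarrow> 'a \<Rightarrow> bool" where
  "atiyah_formula_zero p R \<psi> r r' \<longleftrightarrow>
     r' \<in> carrier R \<and> \<psi> r = add_pow R p r' \<oplus>\<^bsub>R\<^esub> r [^]\<^bsub>R\<^esub> p"

locale pre_psi_algebra = filtered_algebra R I for R (structure) and I +
  fixes p :: nat and \<psi> :: "'a \<Rightarrow> 'a"
  assumes psi_hom: "\<psi> \<in> ring_hom R R"
    and filtration_even: "n \<ge> 1 \<Longrightarrow> I (2 * n) = I (2 * n - 1)"
    and atiyah_pos: "\<lbrakk>q > 0; r \<in> I (2 * q)\<rbrakk> \<Longrightarrow> \<exists>f. atiyah_formula p R I \<psi> q r f"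
    and atiyah_zero: "r \<in> I 0 \<Longrightarrow> \<exists>r'. atiyah_formula_zero p R \<psi> r r'"
    and atiyah_unique:
      "\<lbrakk>q > 0; r \<in> I (2 * q); atiyah_formula p R I \<psi> q r f; atiyah_formula p R I \<psi> q r g; i \<le> q\<rbrakk>
        \<Longrightarrow> gr_mod_class p R I (2 * q + 2 * i * (p - 1)) (f i)
          = gr_mod_class p R I (2 * q + 2 * i * (p - 1)) (g i)"

text \<open>
  \<open>operation_value p R I \<psi> i q x y\<close> says that \<open>y\<close> is a value prescribed for \<open>P\<^sup>i x\<close> by some lift of
  \<open>x\<close> (of degree \<open>2q\<close>) to an element in filtration exactly \<open>2q\<close> and some Atiyah formula for
  that lift. The class \<open>x = 0\<close> need not have a lift in filtration exactly \<open>2q\<close>.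
\<close>

definition operation_value ::
  "nat \<Rightarrow> ('a, 'm) ring_scheme \<Rightarrow> (nat \<Rightarrow> 'a set) \<Rightarrow> ('a \<Rightarrow> 'a) \<Rightarrow> nat \<Rightarrow> nat
    \<Rightarrow> 'a gr_mod \<Rightarrow> 'a gr_mod \<Rightarrow> bool" where
  "operation_value p R I \<psi> i q x y \<longleftrightarrow>
    (\<exists>r \<in> I (2 * q) - I (2 * q + 2).
       gr_mod_class p R I (2 * q) r = x \<and>
       (if q = 0 then
          (\<exists>r'. atiyah_formula_zero p R \<psi> r r') \<and>
          y = (if i = 0 then x [^]\<^bsub>gr_mod_ring p R I\<^esub> p else \<zero>\<^bsub>gr_mod_ring p R I\<^esub>)
        else
          (\<exists>f. atiyah_formula p R I \<psi> q r f \<and>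
            y = (if i \<le> q then gr_mod_class p R I (2 * q + 2 * i * (p - 1)) (f i)
                 else \<zero>\<^bsub>gr_mod_ring p R I\<^esub>))))"

end

theory Submission
  imports Defs "HOL-Algebra.UnivPoly" "HOL-Algebra.Subrings"
begin

text \<open>
  Write \<open>c\<close> for classes in \<open>Gr R \<otimes> \<int>/p\<close>. For \<open>r\<close> in filtration \<open>2q\<close> the class \<open>c(r\<^sub>i)\<close> of the \<open>i\<close>-th term of
  an Atiyah formula depends on \<open>r\<close> only. The formula may even be relaxed by allowing the top term to
  be \<open>r\<^sup>p + p u\<close> with \<open>u\<close> in filtration \<open>2pq\<close>: moving \<open>u\<close> to the term of index \<open>q - 1\<close> gives an Atiyah
  formula with the same classes. Relaxed formulas for \<open>r\<close> and \<open>s\<close> can be added, since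
  \<open>r\<^sup>p + s\<^sup>p - (r + s)\<^sup>p\<close> is divisible by \<open>p\<close>, and multiplied as polynomials, which gives additivity and
  the product formula. If \<open>r\<close> is in filtration \<open>2q + 2\<close>, a formula there,
  \<open>\<psi>(r) = p\<^sup>q\<^sup>+\<^sup>1 r\<^sub>0 + \<dots> + p r\<^sub>q + r\<^sub>q\<^sub>+\<^sub>1\<close>, is a relaxed formula in filtration \<open>2q\<close> with terms
  \<open>p r\<^sub>0, \<dots>, p r\<^sub>q\<^sub>-\<^sub>1, p r\<^sub>q + r\<^sub>q\<^sub>+\<^sub>1\<close>, all of class zero. So \<open>r \<mapsto> c(r\<^sub>i)\<close> factors through \<open>Gr\<^sup>2\<^sup>q R\<close>, and
  it extends to \<open>Gr R \<otimes> \<int>/p\<close> by the universal properties of direct sum and tensor product.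
\<close>

section \<open>Tensor products\<close>

lemma frag_extend_fun_add:
  "frag_extend (\<lambda>x. f x + g x) c = frag_extend f c + frag_extend g c"
  by (simp add: frag_extend_def frag_cmul_distrib2 sum.distrib)

lemma carrier_free_pair_ring [simp]:
  "x \<in> carrier (free_pair_ring A B) \<longleftrightarrow> Poly_Mapping.keys x \<subseteq> carrier A \<times> carrier B"
  by (simp add: free_pair_ring_def)

lemma add_free_pair_ring [simp]: "x \<oplus>\<^bsub>free_pair_ring A B\<^esub> y = x + y"
  by (simp add: free_pair_ring_def)

lemma zero_free_pair_ring [simp]: "\<zero>\<^bsub>free_pair_ring A B\<^esub> = 0"
  by (simp add: free_pair_ring_def)

lemma one_free_pair_ring: "\<one>\<^bsub>free_pair_ring A B\<^esub> = frag_of (\<one>\<^bsub>A\<^esub>, \<one>\<^bsub>B\<^esub>)"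
  by (simp add: free_pair_ring_def)

lemma mult_free_pair_ring_of [simp]:
  "frag_of (a, b) \<otimes>\<^bsub>free_pair_ring A B\<^esub> frag_of (c, d) = frag_of (a \<otimes>\<^bsub>A\<^esub> c, b \<otimes>\<^bsub>B\<^esub> d)"
  by (simp add: free_pair_ring_def)

text \<open>On the left this is additivity of the outer extension; on the right the inner extension
  is additive, and the outer one is additive in the function that it extends.\<close>

lemma mult_free_pair_ring_distrib:
  shows "(x + y) \<otimes>\<^bsub>free_pair_ring A B\<^esub> z = x \<otimes>\<^bsub>free_pair_ring A B\<^esub> z + y \<otimes>\<^bsub>free_pair_ring A B\<^esub> z"
    and "z \<otimes>\<^bsub>free_pair_ring A B\<^esub> (x + y) = z \<otimes>\<^bsub>free_pair_ring A B\<^esub> x + z \<otimes>\<^bsub>free_pair_ring A B\<^esub> y"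
  by (simp_all add: free_pair_ring_def frag_extend_add frag_extend_fun_add case_prod_unfold)

lemma mult_free_pair_ring_zero [simp]:
  shows "0 \<otimes>\<^bsub>free_pair_ring A B\<^esub> z = 0" and "z \<otimes>\<^bsub>free_pair_ring A B\<^esub> 0 = 0"
  using mult_free_pair_ring_distrib(1)[of A B 0 0 z] mult_free_pair_ring_distrib(2)[of A B z 0 0]
  by simp_all

lemma mult_free_pair_ring_diff:
  shows "(x - y) \<otimes>\<^bsub>free_pair_ring A B\<^esub> z = x \<otimes>\<^bsub>free_pair_ring A B\<^esub> z - y \<otimes>\<^bsub>free_pair_ring A B\<^esub> z"
    and "z \<otimes>\<^bsub>free_pair_ring A B\<^esub> (x - y) = z \<otimes>\<^bsub>free_pair_ring A B\<^esub> x - z \<otimes>\<^bsub>free_pair_ring A B\<^esub> y"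
  by (metis add_diff_cancel diff_add_cancel mult_free_pair_ring_distrib(1),
      metis add_diff_cancel diff_add_cancel mult_free_pair_ring_distrib(2))

text \<open>Carrier and addition agree with those of \<open>free_Abelian_group\<close>, so
  commutativity and the universal property of free abelian groups become available for the additive
  group of the ring.\<close>

lemma add_monoid_free_pair_ring:
  "comm_group (add_monoid (free_pair_ring A B))"
  "hom (add_monoid (free_pair_ring A B)) G = hom (free_Abelian_group (carrier A \<times> carrier B)) G"
proof -
  show "comm_group (add_monoid (free_pair_ring A B))"
    using abelian_free_Abelian_group[of "carrier A \<times> carrier B"]
    by (simp add: free_pair_ring_def free_Abelian_group_def)
  show "hom (add_monoid (free_pair_ring A B)) G = hom (free_Abelian_group (carrier A \<times> carrier B)) G"
    by (simp add: hom_def free_pair_ring_def)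
qed

locale tensor_product = A: cring A + B: cring B
  for A :: "('a, 'm) ring_scheme" and B :: "('b, 'n) ring_scheme"
begin

abbreviation "F \<equiv> free_pair_ring A B"
abbreviation "K \<equiv> tensor_kernel A B"
abbreviation "T \<equiv> tensor_ring A B"
abbreviation "pure \<equiv> pure_tensor A B"

text \<open>The product is biadditive, so each ring axiom below is reduced by this rule to
  generators, where it is the same axiom in both factors.\<close>

lemma free_pair_induct [consumes 1, case_names zero diff of]:
  assumes "x \<in> carrier F" "P 0"
    and "\<And>x y. \<lbrakk>x \<in> carrier F; y \<in> carrier F; P x; P y\<rbrakk> \<Longrightarrow> P (x - y)"
    and "\<And>a b. \<lbrakk>a \<in> carrier A; b \<in> carrier B\<rbrakk> \<Longrightarrow> P (frag_of (a, b))"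
  shows "P x"
  by (rule free_Abelian_group_induct[of x "carrier A \<times> carrier B"]) (use assms in auto)

lemma diff_free_pair_closed: "\<lbrakk>x \<in> carrier F; y \<in> carrier F\<rbrakk> \<Longrightarrow> x - y \<in> carrier F"
  using keys_diff[of x y] by auto

lemma mult_free_pair_closed:
  assumes "x \<in> carrier F" "y \<in> carrier F"
  shows "x \<otimes>\<^bsub>F\<^esub> y \<in> carrier F"
  using assms
proof (induction x rule: free_pair_induct)
  case (of a b)
  show ?case using of(3,1,2)
    \<comment> \<open>Membership first stays folded, so that closure under differences applies; only
      the remaining goals about 0 and generators are unfolded to supports.\<close>
    by (induction y rule: free_pair_induct)
       (simp_all add: mult_free_pair_ring_diff diff_free_pair_closed del: carrier_free_pair_ring, simp_all)
qed (simp_all add: mult_free_pair_ring_diff diff_free_pair_closed del: carrier_free_pair_ring, simp_all)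

lemma mult_free_pair_assoc:
  assumes "x \<in> carrier F" "y \<in> carrier F" "z \<in> carrier F"
  shows "x \<otimes>\<^bsub>F\<^esub> y \<otimes>\<^bsub>F\<^esub> z = x \<otimes>\<^bsub>F\<^esub> (y \<otimes>\<^bsub>F\<^esub> z)"
  using assms
proof (induction x rule: free_pair_induct)
  case (of a b)
  note ab = of(1,2)
  show ?case using of(3,4)
  proof (induction y rule: free_pair_induct)
    case (of c d)
    note cd = of(1,2)
    show ?case using of(3)
      by (induction z rule: free_pair_induct)
         (simp_all add: mult_free_pair_ring_diff ab cd A.m_assoc B.m_assoc)
  qed (simp_all add: mult_free_pair_ring_diff)
qed (simp_all add: mult_free_pair_ring_diff)

lemma mult_free_pair_comm:
  assumes "x \<in> carrier F" "y \<in> carrier F"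
  shows "x \<otimes>\<^bsub>F\<^esub> y = y \<otimes>\<^bsub>F\<^esub> x"
  using assms
proof (induction x rule: free_pair_induct)
  case (of a b)
  show ?case using of(3,1,2)
    by (induction y rule: free_pair_induct)
       (simp_all add: mult_free_pair_ring_diff A.m_comm B.m_comm)
qed (simp_all add: mult_free_pair_ring_diff)

lemma mult_free_pair_one:
  assumes "x \<in> carrier F"
  shows "\<one>\<^bsub>F\<^esub> \<otimes>\<^bsub>F\<^esub> x = x"
  using assms
  by (induction x rule: free_pair_induct) (simp_all add: mult_free_pair_ring_diff one_free_pair_ring)

lemma free_pair_cring: "cring F"
proof (rule cringI)
  show "abelian_group F"
    by (rule comm_group_abelian_groupI, rule add_monoid_free_pair_ring)
  show "comm_monoid F"
  proof (rule comm_monoidI)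
    show "\<one>\<^bsub>F\<^esub> \<in> carrier F" by (simp add: one_free_pair_ring)
  qed (fact mult_free_pair_closed mult_free_pair_assoc mult_free_pair_comm mult_free_pair_one)+
qed (simp add: mult_free_pair_ring_distrib)

sublocale F: cring F
  by (rule free_pair_cring)

section \<open>The relation subgroup as an ideal, and the quotient ring\<close>

lemma a_inv_free_pair: "x \<in> carrier F \<Longrightarrow> \<ominus>\<^bsub>F\<^esub> x = - x"
  by (rule F.minus_equality) auto

lemma tensor_relations_left:
  "\<lbrakk>a \<in> carrier A; a' \<in> carrier A; b \<in> carrier B\<rbrakk>
    \<Longrightarrow> frag_of (a \<oplus>\<^bsub>A\<^esub> a', b) - frag_of (a, b) - frag_of (a', b) \<in> tensor_relations A B"
  unfolding tensor_relations_def by (rule UnI1) blast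

lemma tensor_relations_right:
  "\<lbrakk>a \<in> carrier A; b \<in> carrier B; b' \<in> carrier B\<rbrakk>
    \<Longrightarrow> frag_of (a, b \<oplus>\<^bsub>B\<^esub> b') - frag_of (a, b) - frag_of (a, b') \<in> tensor_relations A B"
  unfolding tensor_relations_def by (rule UnI2) blast

lemma tensor_relations_closed: "tensor_relations A B \<subseteq> carrier F"
  unfolding tensor_relations_def
  by (auto simp del: carrier_free_pair_ring intro!: diff_free_pair_closed) simp_all

lemma tensor_kernel_subgroup: "subgroup K (add_monoid F)"
  unfolding tensor_kernel_def
  by (rule F.add.generate_is_subgroup) (use tensor_relations_closed in auto)

text \<open>By distributivity in either factor, a generator times a biadditivity relation is again
  such a relation. This passes to the generated subgroup in the right factor, and then to all of
  \<open>F\<close> in the left factor.\<close>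

lemma mult_tensor_kernel:
  assumes "x \<in> carrier F" "k \<in> K"
  shows "x \<otimes>\<^bsub>F\<^esub> k \<in> K"
proof -
  note K = tensor_kernel_subgroup
  have rel: "r \<in> K" if "r \<in> tensor_relations A B" for r
    unfolding tensor_kernel_def using that by (rule generate.incl)
  have of_rel: "frag_of (a, b) \<otimes>\<^bsub>F\<^esub> r \<in> K"
    if "a \<in> carrier A" "b \<in> carrier B" "r \<in> tensor_relations A B" for a b r
    using that(3) unfolding tensor_relations_def
  proof (elim UnE CollectE exE conjE)
    fix c c' d assume "r = frag_of (c \<oplus>\<^bsub>A\<^esub> c', d) - frag_of (c, d) - frag_of (c', d)"
      and *: "c \<in> carrier A" "c' \<in> carrier A" "d \<in> carrier B"
    then have "frag_of (a, b) \<otimes>\<^bsub>F\<^esub> r = frag_of (a \<otimes>\<^bsub>A\<^esub> c \<oplus>\<^bsub>A\<^esub> a \<otimes>\<^bsub>A\<^esub> c', b \<otimes>\<^bsub>B\<^esub> d)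
        - frag_of (a \<otimes>\<^bsub>A\<^esub> c, b \<otimes>\<^bsub>B\<^esub> d) - frag_of (a \<otimes>\<^bsub>A\<^esub> c', b \<otimes>\<^bsub>B\<^esub> d)"
      using that by (simp add: mult_free_pair_ring_diff A.r_distr)
    also have "\<dots> \<in> K"
      by (rule rel, rule tensor_relations_left) (use that * in auto)
    finally show ?thesis .
  next
    fix c d d' assume "r = frag_of (c, d \<oplus>\<^bsub>B\<^esub> d') - frag_of (c, d) - frag_of (c, d')"
      and *: "c \<in> carrier A" "d \<in> carrier B" "d' \<in> carrier B"
    then have "frag_of (a, b) \<otimes>\<^bsub>F\<^esub> r = frag_of (a \<otimes>\<^bsub>A\<^esub> c, b \<otimes>\<^bsub>B\<^esub> d \<oplus>\<^bsub>B\<^esub> b \<otimes>\<^bsub>B\<^esub> d')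
        - frag_of (a \<otimes>\<^bsub>A\<^esub> c, b \<otimes>\<^bsub>B\<^esub> d) - frag_of (a \<otimes>\<^bsub>A\<^esub> c, b \<otimes>\<^bsub>B\<^esub> d')"
      using that by (simp add: mult_free_pair_ring_diff B.r_distr)
    also have "\<dots> \<in> K"
      by (rule rel, rule tensor_relations_right) (use that * in auto)
    finally show ?thesis .
  qed
  have of_ker: "frag_of (a, b) \<otimes>\<^bsub>F\<^esub> k \<in> K" if ab: "a \<in> carrier A" "b \<in> carrier B" for a b
    using assms(2)[unfolded tensor_kernel_def]
  proof (induction rule: generate.induct)
    case one
    then show ?case using subgroup.one_closed[OF K] by simp
  next
    case (incl h)
    show ?case by (rule of_rel[OF ab incl(1)])
  next
    case (inv h)
    have "h \<in> carrier F" using inv(1) tensor_relations_closed by blast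
    moreover have "frag_of (a, b) \<in> carrier F" using ab by simp
    ultimately have "frag_of (a, b) \<otimes>\<^bsub>F\<^esub> inv\<^bsub>add_monoid F\<^esub> h = \<ominus>\<^bsub>F\<^esub> (frag_of (a, b) \<otimes>\<^bsub>F\<^esub> h)"
      using F.r_minus unfolding a_inv_def by metis
    then show ?case
      using subgroup.m_inv_closed[OF K of_rel[OF ab inv(1)]] by (simp add: a_inv_def)
  next
    case (eng h1 h2)
    then show ?case
      using subgroup.m_closed[OF K eng.IH] by (simp add: mult_free_pair_ring_distrib)
  qed
  have KF: "K \<subseteq> carrier F" using subgroup.subset[OF K] by simp
  show ?thesis using assms(1)
  proof (induction x rule: free_pair_induct)
    case zero
    then show ?case using subgroup.one_closed[OF K] by simp
  next
    case (diff x y)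
    have k: "k \<in> carrier F" using KF assms(2) by blast
    have "x \<otimes>\<^bsub>F\<^esub> k \<oplus>\<^bsub>F\<^esub> \<ominus>\<^bsub>F\<^esub> (y \<otimes>\<^bsub>F\<^esub> k) \<in> K"
      using subgroup.m_closed[OF K diff(3) subgroup.m_inv_closed[OF K diff(4)]] by (simp add: a_inv_def)
    then show ?case
      using a_inv_free_pair[OF mult_free_pair_closed[OF diff(2) k]]
      by (simp add: mult_free_pair_ring_diff)
  next
    case (of a b)
    then show ?case by (rule of_ker)
  qed
qed

lemma tensor_kernel_ideal: "ideal K F"
proof (rule idealI)
  note K = tensor_kernel_subgroup
  show "subgroup K (add_monoid F)" by (rule K)
  fix k x assume *: "k \<in> K" "x \<in> carrier F"
  show "x \<otimes>\<^bsub>F\<^esub> k \<in> K" by (rule mult_tensor_kernel) fact+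
  then show "k \<otimes>\<^bsub>F\<^esub> x \<in> K"
    using F.m_comm[of k x] * subgroup.subset[OF K] by auto
qed (rule F.ring_axioms)

sublocale K: ideal K F
  by (rule tensor_kernel_ideal)

sublocale T: cring T
  unfolding tensor_ring_def by (rule K.quotient_is_cring) (rule free_pair_cring)

section \<open>Pure tensors and the universal property\<close>

lemma pure_closed [simp]: "\<lbrakk>a \<in> carrier A; b \<in> carrier B\<rbrakk> \<Longrightarrow> pure a b \<in> carrier T"
  unfolding pure_tensor_def tensor_ring_def FactRing_def by (simp add: F.a_rcosetsI K.a_subset)

lemma rcos_tensor_hom: "ring_hom_ring F T ((+>\<^bsub>F\<^esub>) K)"
  unfolding tensor_ring_def by (rule K.rcos_ring_hom_ring)

lemma rcos_eqI:
  assumes "x \<in> carrier F" "y \<in> carrier F" "x - y \<in> K"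
  shows "K +>\<^bsub>F\<^esub> x = K +>\<^bsub>F\<^esub> y"
proof -
  have "x \<ominus>\<^bsub>F\<^esub> y = x - y" using assms by (simp add: a_minus_def a_inv_free_pair)
  then have "x \<in> K +>\<^bsub>F\<^esub> y"
    using K.a_rcos_module_minus[OF F.ring_axioms assms(2,1)] assms(3) by simp
  then show ?thesis
    using K.a_repr_independence' assms(2) by metis
qed

lemma rcos_add: "\<lbrakk>x \<in> carrier F; y \<in> carrier F\<rbrakk> \<Longrightarrow> K +>\<^bsub>F\<^esub> (x + y) = (K +>\<^bsub>F\<^esub> x) \<oplus>\<^bsub>T\<^esub> (K +>\<^bsub>F\<^esub> y)"
  using ring_hom_add[OF ring_hom_ring.homh[OF rcos_tensor_hom], of x y] by simp

lemma pure_add_left: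
  assumes "a \<in> carrier A" "a' \<in> carrier A" "b \<in> carrier B"
  shows "pure (a \<oplus>\<^bsub>A\<^esub> a') b = pure a b \<oplus>\<^bsub>T\<^esub> pure a' b"
proof -
  have "frag_of (a \<oplus>\<^bsub>A\<^esub> a', b) - (frag_of (a, b) + frag_of (a', b)) \<in> K"
    unfolding tensor_kernel_def
    using tensor_relations_left[OF assms] by (simp add: generate.incl diff_diff_eq)
  then have "K +>\<^bsub>F\<^esub> frag_of (a \<oplus>\<^bsub>A\<^esub> a', b) = K +>\<^bsub>F\<^esub> (frag_of (a, b) + frag_of (a', b))"
    by (intro rcos_eqI) (use assms keys_add[of "frag_of (a, b)" "frag_of (a', b)"] in auto)
  then show ?thesis
    using assms by (simp add: pure_tensor_def rcos_add)
qed

lemma pure_add_right: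
  assumes "a \<in> carrier A" "b \<in> carrier B" "b' \<in> carrier B"
  shows "pure a (b \<oplus>\<^bsub>B\<^esub> b') = pure a b \<oplus>\<^bsub>T\<^esub> pure a b'"
proof -
  have "frag_of (a, b \<oplus>\<^bsub>B\<^esub> b') - (frag_of (a, b) + frag_of (a, b')) \<in> K"
    unfolding tensor_kernel_def
    using tensor_relations_right[OF assms] by (simp add: generate.incl diff_diff_eq)
  then have "K +>\<^bsub>F\<^esub> frag_of (a, b \<oplus>\<^bsub>B\<^esub> b') = K +>\<^bsub>F\<^esub> (frag_of (a, b) + frag_of (a, b'))"
    by (intro rcos_eqI) (use assms keys_add[of "frag_of (a, b)" "frag_of (a, b')"] in auto)
  then show ?thesis
    using assms by (simp add: pure_tensor_def rcos_add)
qed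

lemma pure_mult:
  assumes "a \<in> carrier A" "b \<in> carrier B" "c \<in> carrier A" "d \<in> carrier B"
  shows "pure a b \<otimes>\<^bsub>T\<^esub> pure c d = pure (a \<otimes>\<^bsub>A\<^esub> c) (b \<otimes>\<^bsub>B\<^esub> d)"
  using ring_hom_mult[OF ring_hom_ring.homh[OF rcos_tensor_hom], of "frag_of (a, b)" "frag_of (c, d)"] assms
  by (simp add: pure_tensor_def)

lemma pure_one: "pure \<one>\<^bsub>A\<^esub> \<one>\<^bsub>B\<^esub> = \<one>\<^bsub>T\<^esub>"
  using ring_hom_one[OF ring_hom_ring.homh[OF rcos_tensor_hom]]
  by (simp add: pure_tensor_def one_free_pair_ring)

lemma pure_minus_right:
  assumes "a \<in> carrier A" "b \<in> carrier B" "b' \<in> carrier B"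
  shows "pure a (b \<ominus>\<^bsub>B\<^esub> b') = pure a b \<ominus>\<^bsub>T\<^esub> pure a b'"
proof -
  have "b = (b \<ominus>\<^bsub>B\<^esub> b') \<oplus>\<^bsub>B\<^esub> b'"
    using assms by (simp add: B.minus_eq B.a_assoc B.l_neg)
  then have "pure a b = pure a (b \<ominus>\<^bsub>B\<^esub> b') \<oplus>\<^bsub>T\<^esub> pure a b'"
    using pure_add_right[of a "b \<ominus>\<^bsub>B\<^esub> b'" b'] assms by simp
  then show ?thesis
    using assms by (simp add: T.minus_eq T.a_assoc T.r_neg)
qed

text \<open>A representative in the free group is a combination of pairs, and the class of a pair is
  a pure tensor.\<close>

lemma tensor_induct [consumes 1, case_names pure diff]:
  assumes "x \<in> carrier T"
    and pure: "\<And>a b. \<lbrakk>a \<in> carrier A; b \<in> carrier B\<rbrakk> \<Longrightarrow> P (pure a b)"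
    and diff: "\<And>x y. \<lbrakk>x \<in> carrier T; y \<in> carrier T; P x; P y\<rbrakk> \<Longrightarrow> P (x \<ominus>\<^bsub>T\<^esub> y)"
  shows "P x"
proof -
  interpret h: ring_hom_ring F T "(+>\<^bsub>F\<^esub>) K" by (rule rcos_tensor_hom)
  obtain f where f: "f \<in> carrier F" "x = K +>\<^bsub>F\<^esub> f"
    using assms(1) unfolding tensor_ring_def FactRing_def A_RCOSETS_def' by auto
  show ?thesis unfolding f(2) using f(1)
  proof (induction f rule: free_pair_induct)
    case zero
    \<comment> \<open>The rule offers no case for zero, which is obtained as a pure tensor minus
      itself.\<close>
    have "P (pure \<zero>\<^bsub>A\<^esub> \<zero>\<^bsub>B\<^esub> \<ominus>\<^bsub>T\<^esub> pure \<zero>\<^bsub>A\<^esub> \<zero>\<^bsub>B\<^esub>)"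
      by (intro diff pure pure_closed) simp_all
    then show ?case
      using h.hom_zero by (simp add: T.minus_eq T.r_neg)
  next
    case (diff f g)
    have "f - g = f \<oplus>\<^bsub>F\<^esub> \<ominus>\<^bsub>F\<^esub> g" using diff by (simp add: a_inv_free_pair)
    also have "K +>\<^bsub>F\<^esub> \<dots> = (K +>\<^bsub>F\<^esub> f) \<ominus>\<^bsub>T\<^esub> (K +>\<^bsub>F\<^esub> g)"
      using diff(1,2) by (simp only: a_minus_def h.hom_add h.hom_a_inv F.a_inv_closed)
    finally show ?case
      using assms(3)[OF h.hom_closed h.hom_closed] diff by metis
  next
    case (of a b)
    then show ?case using pure[of a b] by (simp add: pure_tensor_def)
  qed
qed

text \<open>The map extends to the free group on pairs, biadditivity puts the relations into the
  kernel of the extension, and so it factors through the quotient by \<open>K\<close>.\<close>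

theorem tensor_universal:
  fixes f :: "'a \<Rightarrow> 'b \<Rightarrow> 'c"
  assumes G: "comm_group G"
    and left: "\<And>b. b \<in> carrier B \<Longrightarrow> (\<lambda>a. f a b) \<in> hom (add_monoid A) G"
    and right: "\<And>a. a \<in> carrier A \<Longrightarrow> f a \<in> hom (add_monoid B) G"
  obtains h where "h \<in> hom (add_monoid T) G"
    and "\<And>a b. \<lbrakk>a \<in> carrier A; b \<in> carrier B\<rbrakk> \<Longrightarrow> h (pure a b) = f a b"
proof -
  interpret G: comm_group G by (rule G)
  have f: "f a b \<in> carrier G" if "a \<in> carrier A" "b \<in> carrier B" for a b
    using hom_in_carrier[OF right] that by simp
  obtain h where h: "h \<in> hom (add_monoid F) G"
      "\<And>x. x \<in> carrier A \<times> carrier B \<Longrightarrow> h (frag_of x) = case_prod f x"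
    unfolding add_monoid_free_pair_ring
    by (rule G.free_Abelian_group_universal[of "case_prod f" "carrier A \<times> carrier B"]) (use f in auto)
  interpret h: group_hom "add_monoid F" G h
    by unfold_locales (rule h)
  have diff: "h (x - y) = h x \<otimes>\<^bsub>G\<^esub> inv\<^bsub>G\<^esub> h y" if "x \<in> carrier F" "y \<in> carrier F" for x y
    using h.hom_mult[of x "\<ominus>\<^bsub>F\<^esub> y"] h.hom_inv[of y, folded a_inv_def] F.a_inv_closed[OF that(2)] that
    by (simp add: a_inv_free_pair del: carrier_free_pair_ring)
  \<comment> \<open>Both families of relations have the shape u - v - w with f u the product of f v
    and f w, so one computation serves both.\<close>
  have rel: "h (frag_of u - frag_of v - frag_of w) = \<one>\<^bsub>G\<^esub>"
    if "u \<in> carrier A \<times> carrier B" "v \<in> carrier A \<times> carrier B" "w \<in> carrier A \<times> carrier B"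
      and "case_prod f u = case_prod f v \<otimes>\<^bsub>G\<^esub> case_prod f w" for u v w
  proof -
    have F: "frag_of u \<in> carrier F" "frag_of v \<in> carrier F" "frag_of w \<in> carrier F"
      using that by simp_all
    have "case_prod f v \<in> carrier G" "case_prod f w \<in> carrier G"
      using that(2,3) f by auto
    then show ?thesis
      using that(4) by (simp only: diff diff_free_pair_closed F h(2) that(1-3))
        (simp add: G.m_assoc[of "case_prod f v \<otimes>\<^bsub>G\<^esub> case_prod f w"] flip: G.inv_mult)
  qed
  have "K \<subseteq> kernel (add_monoid F) G h"
    unfolding tensor_kernel_def
  proof (rule F.add.generate_subgroup_incl)
    show "subgroup (kernel (add_monoid F) G h) (add_monoid F)"
      by (rule h.subgroup_kernel)
    show "tensor_relations A B \<subseteq> kernel (add_monoid F) G h"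
    proof
      fix r assume r: "r \<in> tensor_relations A B"
      have "h r = \<one>\<^bsub>G\<^esub>" using r unfolding tensor_relations_def
      proof (elim UnE CollectE exE conjE)
        fix a a' b assume *: "r = frag_of (a \<oplus>\<^bsub>A\<^esub> a', b) - frag_of (a, b) - frag_of (a', b)"
          "a \<in> carrier A" "a' \<in> carrier A" "b \<in> carrier B"
        show ?thesis
          unfolding *(1) by (rule rel) (use hom_mult[OF left, of b a a'] * in simp_all)
      next
        fix a b b' assume *: "r = frag_of (a, b \<oplus>\<^bsub>B\<^esub> b') - frag_of (a, b) - frag_of (a, b')"
          "a \<in> carrier A" "b \<in> carrier B" "b' \<in> carrier B"
        show ?thesis
          unfolding *(1) by (rule rel) (use hom_mult[OF right, of a b b'] * in simp_all)
      qed
      then show "r \<in> kernel (add_monoid F) G h"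
        using r tensor_relations_closed by (auto simp: kernel_def simp del: carrier_free_pair_ring)
    qed
  qed
  moreover have "K \<lhd> add_monoid F"
    using F.add.normal_iff_subgroup K.a_subgroup by blast
  ultimately obtain g where g: "g \<in> hom (add_monoid F Mod K) G"
      "\<And>x. x \<in> carrier (add_monoid F) \<Longrightarrow> g (K #>\<^bsub>add_monoid F\<^esub> x) = h x"
    using h.FactGroup_universal_kernel by metis
  show thesis
  proof
    show "g \<in> hom (add_monoid T) G"
      \<comment> \<open>The factor group of the additive group and the additive group of the factor
        ring have the same cosets and the same operation.\<close>
      using g(1) by (simp add: hom_def tensor_ring_def FactRing_def FactGroup_def A_RCOSETS_def set_add_def)
    show "g (pure a b) = f a b" if "a \<in> carrier A" "b \<in> carrier B" for a b
      using g(2)[of "frag_of (a, b)"] h(2)[of "(a, b)"] that by (simp add: pure_tensor_def a_r_coset_def)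
  qed
qed

end

section \<open>The associated graded ring\<close>

text \<open>Differences of 1 reach every residue: 0 = 1 - 1, -j = 0 - j and m + 1 = m -
  (-1).\<close>

lemma ZFact_induct [consumes 1, case_names one diff]:
  assumes "z \<in> carrier (ZFact k)" and one: "P \<one>\<^bsub>ZFact k\<^esub>"
    and diff: "\<And>x y. \<lbrakk>x \<in> carrier (ZFact k); y \<in> carrier (ZFact k); P x; P y\<rbrakk> \<Longrightarrow> P (x \<ominus>\<^bsub>ZFact k\<^esub> y)"
  shows "P z"
proof -
  let ?c = "\<lambda>j. Idl\<^bsub>\<Z>\<^esub> {k} +>\<^bsub>\<Z>\<^esub> j"
  interpret k: ideal "Idl\<^bsub>\<Z>\<^esub> {k}" \<Z> by (rule int.genideal_ideal) simp
  interpret c: ring_hom_ring \<Z> "ZFact k" ?c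
    unfolding ZFact_def by (rule k.rcos_ring_hom_ring)
  have c_diff: "?c (i - j) = ?c i \<ominus>\<^bsub>ZFact k\<^esub> ?c j" for i j
    using c.hom_add[of i "- j"] c.hom_a_inv[of j] by (simp add: a_minus_def)
  have zero: "P (?c 0)"
    using diff[OF c.hom_closed c.hom_closed, of 1 1] one c.hom_one c_diff[of 1 1] by simp
  have neg: "P (?c (- j))" if "P (?c j)" for j
    using diff[OF c.hom_closed c.hom_closed zero that] c_diff[of 0 j] by simp
  have nat: "P (?c (int m))" for m
  proof (induction m)
    case (Suc m)
    have "P (?c (- 1))" using neg[of 1] one c.hom_one by simp
    then show ?case
      using diff[OF c.hom_closed c.hom_closed Suc, of "- 1"] c_diff[of "int m" "- 1"] by (simp add: add.commute)
  qed (use zero in simp)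
  obtain j where "z = ?c j"
    using assms(1) unfolding ZFact_def FactRing_def A_RCOSETS_def' by auto
  then show ?thesis
    using nat neg[OF nat] by (cases j) metis+
qed

text \<open>The k-fold sum of 1 is the class of k, which lies in the ideal generated by k.\<close>

lemma ZFact_add_pow_one: "add_pow (ZFact (int k)) k \<one>\<^bsub>ZFact (int k)\<^esub> = \<zero>\<^bsub>ZFact (int k)\<^esub>"
proof -
  let ?c = "\<lambda>j. Idl\<^bsub>\<Z>\<^esub> {int k} +>\<^bsub>\<Z>\<^esub> j"
  interpret k: ideal "Idl\<^bsub>\<Z>\<^esub> {int k}" \<Z> by (rule int.genideal_ideal) simp
  interpret c: ring_hom_ring \<Z> "ZFact (int k)" ?c
    unfolding ZFact_def by (rule k.rcos_ring_hom_ring)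
  have "add_pow (ZFact (int k)) m \<one>\<^bsub>ZFact (int k)\<^esub> = ?c (int m)" for m
  proof (induction m)
    case 0
    show ?case using c.hom_zero by simp
  next
    case (Suc m)
    then show ?case using c.hom_add[of "int m" 1] c.hom_one by (simp add: add.commute)
  qed
  then have "add_pow (ZFact (int k)) k \<one>\<^bsub>ZFact (int k)\<^esub> = ?c (int k)" .
  also have "\<dots> = Idl\<^bsub>\<Z>\<^esub> {int k}"
    by (rule k.a_rcos_const) (rule int.genideal_self', simp)
  also have "\<dots> = \<zero>\<^bsub>ZFact (int k)\<^esub>"
    by (simp only: ZFact_def FactRing_def ring.simps)
  finally show ?thesis .
qed

context filtered_algebra
begin

section \<open>The filtration ideals and the graded pieces\<close>

lemma filtration_carrier: "a \<in> I n \<Longrightarrow> a \<in> carrier R"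
  by (rule ideal.Icarr[OF filtration_ideal])

lemma filtration_closed:
  shows "\<zero> \<in> I n"
    and "\<lbrakk>a \<in> I n; b \<in> I n\<rbrakk> \<Longrightarrow> a \<oplus> b \<in> I n"
    and "a \<in> I n \<Longrightarrow> \<ominus> a \<in> I n"
    and "\<lbrakk>a \<in> carrier R; b \<in> I n\<rbrakk> \<Longrightarrow> a \<otimes> b \<in> I n"
    and "\<lbrakk>a \<in> I n; b \<in> carrier R\<rbrakk> \<Longrightarrow> a \<otimes> b \<in> I n"
proof -
  interpret fil: ideal "I n" R by (rule filtration_ideal)
  show "\<zero> \<in> I n" by (rule fil.zero_closed)
  show "\<lbrakk>a \<in> I n; b \<in> I n\<rbrakk> \<Longrightarrow> a \<oplus> b \<in> I n" by (rule fil.a_closed)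
  show "a \<in> I n \<Longrightarrow> \<ominus> a \<in> I n" by (rule fil.a_inv_closed)
  show "\<lbrakk>a \<in> carrier R; b \<in> I n\<rbrakk> \<Longrightarrow> a \<otimes> b \<in> I n" by (rule fil.I_l_closed)
  show "\<lbrakk>a \<in> I n; b \<in> carrier R\<rbrakk> \<Longrightarrow> a \<otimes> b \<in> I n" by (rule fil.I_r_closed)
qed

lemma filtration_antimono: "m \<le> n \<Longrightarrow> I n \<subseteq> I m"
  by (rule lift_Suc_antimono_le[of I]) (rule filtration_decreasing)

lemma filtration_mult: "\<lbrakk>a \<in> I m; b \<in> I n\<rbrakk> \<Longrightarrow> a \<otimes> b \<in> I (m + n)"
  by (rule subsetD[OF filtration_multiplicative]) (rule ideal_prod.prod)

lemma filtration_pow: "a \<in> I n \<Longrightarrow> a [^] (k :: nat) \<in> I (k * n)"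
proof (induction k)
  case (Suc k)
  then show ?case
    using filtration_mult[of "a [^] k" "k * n" a n] by (simp add: add.commute)
qed (simp add: filtration_zero)

lemma filtration_add_pow: "a \<in> I n \<Longrightarrow> add_pow R (k :: nat) a \<in> I n"
  by (induction k) (auto simp: filtration_closed)

text \<open>A sum over an infinite set is zero by convention, which lies in every ideal of the
  filtration.\<close>

lemma filtration_finsum: "(\<And>i. i \<in> A \<Longrightarrow> h i \<in> I n) \<Longrightarrow> (\<Oplus>i\<in>A. h i) \<in> I n"
proof (induction A rule: infinite_finite_induct)
  case (insert a A)
  then show ?case
    using filtration_carrier by (subst finsum_insert) (auto simp: filtration_closed)
qed (auto simp: filtration_closed)

lemma coset_zero: "a \<in> I n \<Longrightarrow> I n +> a = I n"
proof -
  interpret fil: ideal "I n" R by (rule filtration_ideal)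
  show "a \<in> I n \<Longrightarrow> I n +> a = I n" by (rule fil.a_rcos_const)
qed

lemma filtration_add_subgroup: "subgroup (I n) (add_monoid R)"
  by (rule additive_subgroup.a_subgroup) (rule ideal.axioms(1)[OF filtration_ideal])

lemma filtration_comm_group: "comm_group ((add_monoid R)\<lparr>carrier := I n\<rparr>)"
proof (rule group.group_comm_groupI)
  show "group ((add_monoid R)\<lparr>carrier := I n\<rparr>)"
    by (rule add.subgroup_imp_group) (rule filtration_add_subgroup)
qed (use filtration_carrier a_comm in auto)

lemma filtration_subgroup: "subgroup (I (Suc n)) ((add_monoid R)\<lparr>carrier := I n\<rparr>)"
  by (rule add.subgroup_incl) (auto intro: filtration_add_subgroup filtration_decreasing[THEN subsetD])

lemma gr_piece_comm_group: "comm_group (gr_piece R I n)"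
  unfolding gr_piece_def
  by (rule comm_group.abelian_FactGroup[OF filtration_comm_group filtration_subgroup])

lemma gr_piece_group [simp]: "group (gr_piece R I n)"
  by (rule comm_group.axioms(2)) (rule gr_piece_comm_group)

lemma carrier_gr_piece: "carrier (gr_piece R I n) = (\<lambda>a. I (Suc n) +> a) ` I n"
  by (simp add: gr_piece_def carrier_FactGroup a_r_coset_def r_coset_def)

lemma one_gr_piece [simp]: "\<one>\<^bsub>gr_piece R I n\<^esub> = I (Suc n)"
  by (simp add: gr_piece_def)

lemma mult_gr_piece:
  "\<lbrakk>a \<in> I n; b \<in> I n\<rbrakk>
    \<Longrightarrow> (I (Suc n) +> a) \<otimes>\<^bsub>gr_piece R I n\<^esub> (I (Suc n) +> b) = I (Suc n) +> (a \<oplus> b)"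
proof -
  interpret fil: ideal "I (Suc n)" R by (rule filtration_ideal)
  show "\<lbrakk>a \<in> I n; b \<in> I n\<rbrakk> \<Longrightarrow> ?thesis"
    using fil.a_rcos_sum[of a b] filtration_carrier
    by (simp add: gr_piece_def set_add_def set_mult_def)
qed

lemma finprod_gr_piece:
  assumes "finite A" "\<And>i. i \<in> A \<Longrightarrow> h i \<in> I n"
  shows "finprod (gr_piece R I n) (\<lambda>i. I (Suc n) +> h i) A = I (Suc n) +> (\<Oplus>i\<in>A. h i)"
  using assms
proof (induction A)
  case empty
  interpret comm_group "gr_piece R I n" by (rule gr_piece_comm_group)
  show ?case by (simp add: coset_zero filtration_closed)
next
  case (insert a A)
  interpret gr: comm_group "gr_piece R I n" by (rule gr_piece_comm_group)
  have "(\<lambda>i. I (Suc n) +> h i) \<in> insert a A \<rightarrow> carrier (gr_piece R I n)"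
    using insert.prems by (auto simp: carrier_gr_piece)
  then have "finprod (gr_piece R I n) (\<lambda>i. I (Suc n) +> h i) (insert a A)
      = (I (Suc n) +> h a) \<otimes>\<^bsub>gr_piece R I n\<^esub> (I (Suc n) +> (\<Oplus>i\<in>A. h i))"
    using insert by (subst gr.finprod_insert) auto
  then show ?case
    using insert finsum_insert[of A a h] filtration_carrier[of _ n]
    by (simp add: mult_gr_piece filtration_finsum Pi_def)
qed

text \<open>Changing a by u in \<open>I (Suc k)\<close> and b by v in \<open>I (Suc l)\<close>
  changes the product by an element of \<open>I (Suc (k + l))\<close>. Hence all cosets in the union
  that defines \<open>rcoset_mult\<close> coincide, although the three moduli differ.\<close>

lemma rcoset_mult_filtration:
  assumes a: "a \<in> I k" and b: "b \<in> I l"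
  shows "rcoset_mult R (I (Suc (k + l))) (I (Suc k) +> a) (I (Suc l) +> b) = I (Suc (k + l)) +> (a \<otimes> b)"
proof -
  interpret k: ideal "I (Suc k)" R by (rule filtration_ideal)
  interpret l: ideal "I (Suc l)" R by (rule filtration_ideal)
  interpret kl: ideal "I (Suc (k + l))" R by (rule filtration_ideal)
  have "I (Suc (k + l)) +> (a' \<otimes> b') = I (Suc (k + l)) +> (a \<otimes> b)"
    if a': "a' \<in> I (Suc k) +> a" and b': "b' \<in> I (Suc l) +> b" for a' b'
  proof -
    obtain u v where u: "u \<in> I (Suc k)" "a' = u \<oplus> a" and v: "v \<in> I (Suc l)" "b' = v \<oplus> b"
      using a' b' by (auto simp: a_r_coset_def')
    have "b' \<in> I l"
      using v b filtration_decreasing[of l] by (auto intro: filtration_closed)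
    then have "u \<otimes> b' \<oplus> a \<otimes> v \<in> I (Suc (k + l))"
      using filtration_mult[OF u(1), of b' l] filtration_mult[OF a v(1)] by (simp add: filtration_closed)
    moreover have "a' \<otimes> b' = (u \<otimes> b' \<oplus> a \<otimes> v) \<oplus> a \<otimes> b"
    proof -
      have "u \<in> carrier R" "a \<in> carrier R" "v \<in> carrier R" "b \<in> carrier R"
        using u v a b filtration_carrier by blast+
      then show ?thesis unfolding u(2) v(2) by algebra
    qed
    ultimately have "a' \<otimes> b' \<in> I (Suc (k + l)) +> (a \<otimes> b)"
      by (auto simp: a_r_coset_def')
    then show ?thesis
      using kl.a_repr_independence'[of "a' \<otimes> b'" "a \<otimes> b"] a b filtration_carrier by simp
  qed
  \<comment> \<open>The union of equal cosets is that coset only because its index sets are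
    nonempty.\<close>
  moreover have "a \<in> I (Suc k) +> a" "b \<in> I (Suc l) +> b"
    using a b filtration_carrier k.a_rcos_self l.a_rcos_self by blast+
  ultimately show ?thesis
    unfolding rcoset_mult_def by blast
qed

text \<open>The polynomials \<open>\<Sum> a\<^sub>n X\<^sup>n\<close> with \<open>a\<^sub>n \<in> I\<^sup>n\<close> form a ring that maps onto the associated graded ring,
  which inherits the ring axioms from it.\<close>

definition filtered_polys :: "(nat \<Rightarrow> 'a) set" where
  "filtered_polys = {f \<in> carrier (UP R). \<forall>n. f n \<in> I n}"

definition leading_classes :: "(nat \<Rightarrow> 'a) \<Rightarrow> nat \<Rightarrow> 'a set" where
  "leading_classes f = (\<lambda>n. I (Suc n) +> f n)"

lemma filtered_polysD:
  assumes "f \<in> filtered_polys"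
  shows "f \<in> up R" "f n \<in> I n" "f n \<in> carrier R"
  using assms filtration_carrier by (auto simp: filtered_polys_def UP_def)

text \<open>This is the Rees algebra of the filtration; multiplicativity of the filtration gives
  closure under the Cauchy product.\<close>

lemma filtered_polys_subring: "subring filtered_polys (UP R)"
proof -
  interpret P: UP_cring R "UP R" by unfold_locales simp_all
  show ?thesis
  proof (rule P.subringI)
    show "\<one>\<^bsub>UP R\<^esub> \<in> filtered_polys"
      using P.UP_one_closed by (auto simp: filtered_polys_def) (auto simp: UP_def filtration_zero filtration_closed)
    fix f g assume f: "f \<in> filtered_polys" and g: "g \<in> filtered_polys"
    show "\<ominus>\<^bsub>UP R\<^esub> f \<in> filtered_polys"
    proof -
      have "f \<in> carrier (UP R)" using f by (simp add: filtered_polys_def)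
      moreover from this have "(\<ominus>\<^bsub>UP R\<^esub> f) n = \<ominus> f n" for n
        using P.coeff_a_inv[of f n] P.UP_a_inv_closed[of f] by (simp add: UP_def)
      ultimately show ?thesis
        using f P.UP_a_inv_closed by (simp add: filtered_polys_def filtration_closed)
    qed
    show "f \<oplus>\<^bsub>UP R\<^esub> g \<in> filtered_polys"
      using f g P.UP_a_closed[of f g] by (auto simp: filtered_polys_def) (auto simp: UP_def filtration_closed)
    show "f \<otimes>\<^bsub>UP R\<^esub> g \<in> filtered_polys"
    proof -
      have "f i \<otimes> g (n - i) \<in> I n" if "i \<le> n" for i n
        using filtration_mult[OF filtered_polysD(2)[OF f] filtered_polysD(2)[OF g], of i "n - i"] that by simp
      then have "(\<Oplus>i\<in>{..n}. f i \<otimes> g (n - i)) \<in> I n" for n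
        by (intro filtration_finsum) auto
      then show ?thesis
        using f g P.UP_mult_closed[of f g] by (auto simp: filtered_polys_def) (auto simp: UP_def)
    qed
  qed (auto simp: filtered_polys_def)
qed

lemma carrier_gr_ring: "carrier (gr_ring R I) = leading_classes ` filtered_polys"
proof (intro equalityI subsetI)
  fix x assume "x \<in> carrier (gr_ring R I)"
  then have x: "x n \<in> (\<lambda>a. I (Suc n) +> a) ` I n" and fin: "finite {n. x n \<noteq> I (Suc n)}" for n
    by (auto simp: gr_ring_def carrier_sum_group carrier_gr_piece PiE_iff)
  \<comment> \<open>Trivial classes are represented by zero, so that the finite support of x makes
    the sequence of representatives a polynomial.\<close>
  have "\<exists>a. a \<in> I n \<and> x n = I (Suc n) +> a \<and> (x n = I (Suc n) \<longrightarrow> a = \<zero>)" for n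
  proof (cases "x n = I (Suc n)")
    case True
    then show ?thesis by (intro exI[of _ \<zero>]) (simp add: coset_zero filtration_closed)
  qed (use x in auto)
  then obtain f where f: "\<And>n. f n \<in> I n" "\<And>n. x n = I (Suc n) +> f n" "\<And>n. x n = I (Suc n) \<Longrightarrow> f n = \<zero>"
    by metis
  obtain m where m: "{n. x n \<noteq> I (Suc n)} \<subseteq> {..m}"
    using fin finite_nat_iff_bounded_le by blast
  have "bound \<zero> m f"
  proof
    fix n assume "m < n"
    then have "x n = I (Suc n)" using m by force
    then show "f n = \<zero>" by (rule f(3))
  qed
  then have "f \<in> filtered_polys"
    using f(1) filtration_carrier[OF f(1)] by (auto simp: filtered_polys_def UP_def)
  moreover have "x = leading_classes f"
    using f(2) by (auto simp: leading_classes_def)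
  ultimately show "x \<in> leading_classes ` filtered_polys" by blast
next
  fix x assume "x \<in> leading_classes ` filtered_polys"
  then obtain f where f: "f \<in> filtered_polys" "x = leading_classes f" by blast
  then obtain m where m: "bound \<zero> m f" using filtered_polysD(1) by blast
  have "{n. x n \<noteq> I (Suc n)} \<subseteq> {..m}"
    using bound.bound[OF m] f(2) by (force simp: leading_classes_def coset_zero filtration_closed not_le)
  then show "x \<in> carrier (gr_ring R I)"
    using f(2) filtered_polysD(2)[OF f(1)] finite_subset[OF _ finite_atMost]
    by (auto simp: gr_ring_def carrier_sum_group carrier_gr_piece leading_classes_def)
qed

lemma leading_classes_hom: "leading_classes \<in> ring_hom (UP R\<lparr>carrier := filtered_polys\<rparr>) (gr_ring R I)"
proof (rule ring_hom_memI)
  fix f assume f: "f \<in> carrier (UP R\<lparr>carrier := filtered_polys\<rparr>)"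
  then show "leading_classes f \<in> carrier (gr_ring R I)"
    by (simp add: carrier_gr_ring)
  fix g assume g: "g \<in> carrier (UP R\<lparr>carrier := filtered_polys\<rparr>)"
  note fg = filtered_polysD[of f] filtered_polysD[of g]
  show "leading_classes (f \<oplus>\<^bsub>UP R\<lparr>carrier := filtered_polys\<rparr>\<^esub> g)
      = leading_classes f \<oplus>\<^bsub>gr_ring R I\<^esub> leading_classes g"
    using f g fg by (auto simp: leading_classes_def gr_ring_def UP_def mult_gr_piece)
  show "leading_classes (f \<otimes>\<^bsub>UP R\<lparr>carrier := filtered_polys\<rparr>\<^esub> g)
      = leading_classes f \<otimes>\<^bsub>gr_ring R I\<^esub> leading_classes g"
  proof
    fix n
    have "rcoset_mult R (I (Suc n)) (I (Suc i) +> f i) (I (Suc (n - i)) +> g (n - i))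
        = I (Suc n) +> (f i \<otimes> g (n - i))" "f i \<otimes> g (n - i) \<in> I n" if "i \<in> {..n}" for i
      using rcoset_mult_filtration[of "f i" i "g (n - i)" "n - i"]
        filtration_mult[of "f i" i "g (n - i)" "n - i"] that fg(2,5) f g by simp_all
    note * = this
    interpret gr: comm_group "gr_piece R I n" by (rule gr_piece_comm_group)
    have "(leading_classes f \<otimes>\<^bsub>gr_ring R I\<^esub> leading_classes g) n
      = finprod (gr_piece R I n) (\<lambda>i. rcoset_mult R (I (Suc n)) (I (Suc i) +> f i) (I (Suc (n - i)) +> g (n - i))) {..n}"
      by (simp add: gr_ring_def leading_classes_def)
    also have "\<dots> = finprod (gr_piece R I n) (\<lambda>i. I (Suc n) +> (f i \<otimes> g (n - i))) {..n}"
    proof (rule gr.finprod_cong'[OF refl])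
      show "(\<lambda>i. I (Suc n) +> (f i \<otimes> g (n - i))) \<in> {..n} \<rightarrow> carrier (gr_piece R I n)"
        using *(2) by (auto simp: carrier_gr_piece)
    qed (rule *(1))
    also have "\<dots> = I (Suc n) +> (\<Oplus>i\<in>{..n}. f i \<otimes> g (n - i))"
      using *(2) by (rule finprod_gr_piece[OF finite_atMost])
    also have "\<dots> = leading_classes (f \<otimes>\<^bsub>UP R\<lparr>carrier := filtered_polys\<rparr>\<^esub> g) n"
      using f g fg(1,4) by (simp add: leading_classes_def UP_def)
    finally show "leading_classes (f \<otimes>\<^bsub>UP R\<lparr>carrier := filtered_polys\<rparr>\<^esub> g) n
      = (leading_classes f \<otimes>\<^bsub>gr_ring R I\<^esub> leading_classes g) n" ..
  qed
next
  show "leading_classes \<one>\<^bsub>UP R\<lparr>carrier := filtered_polys\<rparr>\<^esub> = \<one>\<^bsub>gr_ring R I\<^esub>"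
    by (simp add: fun_eq_iff leading_classes_def UP_def gr_ring_def coset_zero filtration_closed)
qed

lemma leading_classes_zero: "leading_classes \<zero>\<^bsub>UP R\<^esub> = \<zero>\<^bsub>gr_ring R I\<^esub>"
  by (simp add: fun_eq_iff leading_classes_def UP_def gr_ring_def coset_zero filtration_closed)

lemma filtered_polys_cring: "cring (UP R\<lparr>carrier := filtered_polys\<rparr>)"
proof -
  interpret P: UP_cring R "UP R" by unfold_locales simp_all
  show ?thesis
    using P.subcringI'[OF filtered_polys_subring]
    by (rule P.subcring_iff[OF subringE(1)[OF filtered_polys_subring], THEN iffD1])
qed

lemma gr_ring_cring: "cring (gr_ring R I)"
proof -
  let ?S = "UP R\<lparr>carrier := filtered_polys\<rparr>"
  interpret S: cring ?S by (rule filtered_polys_cring)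
  \<comment> \<open>The ring structure is transferred to the image with carrier and zero
    overwritten; as the map is onto and preserves zero, both updates change nothing.\<close>
  have "gr_ring R I\<lparr>carrier := leading_classes ` carrier ?S, zero := leading_classes \<zero>\<^bsub>?S\<^esub>\<rparr>
      = gr_ring R I\<lparr>carrier := carrier (gr_ring R I), zero := \<zero>\<^bsub>gr_ring R I\<^esub>\<rparr>"
    by (simp add: carrier_gr_ring leading_classes_zero)
  then have "ring (gr_ring R I)"
    using S.ring_hom_imp_img_ring[OF leading_classes_hom] by simp
  then interpret gr: ring "gr_ring R I" .
  show ?thesis
  proof (intro cring.intro comm_monoid.intro comm_monoid_axioms.intro)
    fix x y assume "x \<in> carrier (gr_ring R I)" "y \<in> carrier (gr_ring R I)"
    then obtain f g where fg: "f \<in> carrier ?S" "g \<in> carrier ?S"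
      and "x = leading_classes f" "y = leading_classes g"
      unfolding carrier_gr_ring by auto
    then show "x \<otimes>\<^bsub>gr_ring R I\<^esub> y = y \<otimes>\<^bsub>gr_ring R I\<^esub> x"
      using S.m_comm[OF fg] by (simp only: ring_hom_mult[OF leading_classes_hom, symmetric])
  qed (rule gr.ring_axioms gr.monoid_axioms)+
qed

end

section \<open>The graded ring modulo \<open>p\<close>\<close>

locale filtered_algebra_mod = filtered_algebra R I for R (structure) and I +
  fixes p :: nat
begin

abbreviation "A \<equiv> gr_mod_ring p R I"
abbreviation "cl \<equiv> gr_mod_class p R I"

sublocale gr: tensor_product "gr_ring R I" "ZFact (int p)"
  by (intro tensor_product.intro gr_ring_cring ZFact_is_cring)

sublocale A: cring A
  unfolding gr_mod_ring_def by (rule gr.T.cring_axioms)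

text \<open>The ring homomorphism from the Rees algebra to \<open>A\<close>. It sends the monomial r
  X^n to \<open>cl n r\<close>, so the calculus of classes is read off that of monomials.\<close>

definition poly_class :: "(nat \<Rightarrow> 'a) \<Rightarrow> 'a gr_mod" where
  "poly_class f = pure_tensor (gr_ring R I) (ZFact (int p)) (leading_classes f) \<one>\<^bsub>ZFact (int p)\<^esub>"

lemma poly_class_hom: "poly_class \<in> ring_hom (UP R\<lparr>carrier := filtered_polys\<rparr>) A"
proof (rule ring_hom_memI)
  show "poly_class \<one>\<^bsub>UP R\<lparr>carrier := filtered_polys\<rparr>\<^esub> = \<one>\<^bsub>A\<^esub>"
    using gr.pure_one ring_hom_one[OF leading_classes_hom] by (simp add: poly_class_def gr_mod_ring_def)
  fix f g assume "f \<in> carrier (UP R\<lparr>carrier := filtered_polys\<rparr>)" "g \<in> carrier (UP R\<lparr>carrier := filtered_polys\<rparr>)"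
  then show "poly_class (f \<otimes>\<^bsub>UP R\<lparr>carrier := filtered_polys\<rparr>\<^esub> g) = poly_class f \<otimes>\<^bsub>A\<^esub> poly_class g"
    and "poly_class (f \<oplus>\<^bsub>UP R\<lparr>carrier := filtered_polys\<rparr>\<^esub> g) = poly_class f \<oplus>\<^bsub>A\<^esub> poly_class g"
    unfolding poly_class_def gr_mod_ring_def
    by (simp_all only: ring_hom_mult[OF leading_classes_hom] ring_hom_add[OF leading_classes_hom]
        ring_hom_closed[OF leading_classes_hom] gr.pure_mult gr.pure_add_left gr.B.one_closed gr.B.l_one)
qed (simp add: poly_class_def gr_mod_ring_def carrier_gr_ring)

lemma monom_filtered: "r \<in> I n \<Longrightarrow> monom (UP R) r n \<in> filtered_polys"
proof -
  interpret P: UP_cring R "UP R" by unfold_locales simp_all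
  show "r \<in> I n \<Longrightarrow> ?thesis"
    using filtration_carrier[of r n] P.monom_closed[of r n]
    by (auto simp: filtered_polys_def) (auto simp: UP_def filtration_closed)
qed

lemma gr_embed_coset:
  "r \<in> I n \<Longrightarrow> gr_embed R I n (I (Suc n) +> r) = leading_classes (monom (UP R) r n)"
  using filtration_carrier[of r n]
  by (simp add: fun_eq_iff gr_embed_def leading_classes_def UP_def coset_zero filtration_closed)

lemma class_eq_poly_class: "r \<in> I n \<Longrightarrow> cl n r = poly_class (monom (UP R) r n)"
  by (simp add: gr_mod_class_def poly_class_def gr_embed_coset)

lemma class_closed: "r \<in> I n \<Longrightarrow> cl n r \<in> carrier A"
  using ring_hom_closed[OF poly_class_hom] monom_filtered by (simp add: class_eq_poly_class)

lemma class_add: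
  assumes "r \<in> I n" "s \<in> I n"
  shows "cl n (r \<oplus> s) = cl n r \<oplus>\<^bsub>A\<^esub> cl n s"
proof -
  interpret P: UP_cring R "UP R" by unfold_locales simp_all
  show ?thesis
    using ring_hom_add[OF poly_class_hom, of "monom (UP R) r n" "monom (UP R) s n"]
      assms filtration_carrier[of _ n]
    by (simp add: class_eq_poly_class filtration_closed monom_filtered)
qed

lemma class_mult:
  assumes "r \<in> I m" "s \<in> I n"
  shows "cl m r \<otimes>\<^bsub>A\<^esub> cl n s = cl (m + n) (r \<otimes> s)"
proof -
  interpret P: UP_cring R "UP R" by unfold_locales simp_all
  show ?thesis
    using ring_hom_mult[OF poly_class_hom, of "monom (UP R) r m" "monom (UP R) s n"]
      assms filtration_carrier
    by (simp add: class_eq_poly_class filtration_mult monom_filtered)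
qed

lemma class_one: "cl 0 \<one> = \<one>\<^bsub>A\<^esub>"
proof -
  interpret P: UP_cring R "UP R" by unfold_locales simp_all
  show ?thesis
    using ring_hom_one[OF poly_class_hom] by (simp add: class_eq_poly_class filtration_zero)
qed

lemma class_zero:
  assumes "r \<in> I (Suc n)"
  shows "cl n r = \<zero>\<^bsub>A\<^esub>"
proof -
  have "cl n r = cl n \<zero>"
    by (simp add: gr_mod_class_def coset_zero assms filtration_closed)
  also have "\<dots> = \<zero>\<^bsub>A\<^esub>"
    using class_add[of \<zero> n \<zero>] class_closed[of \<zero> n] by (simp add: filtration_closed)
  finally show ?thesis .
qed

lemma class_pow: "r \<in> I n \<Longrightarrow> cl n r [^]\<^bsub>A\<^esub> (k :: nat) = cl (k * n) (r [^] k)"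
proof (induction k)
  case (Suc k)
  then show ?case
    by (simp add: class_mult filtration_pow add.commute)
qed (simp add: class_one)

lemma class_add_pow: "r \<in> I n \<Longrightarrow> cl n (add_pow R (k :: nat) r) = add_pow A k (cl n r)"
  by (induction k) (simp_all add: class_zero filtration_closed class_add filtration_add_pow)

lemma class_finsum:
  assumes "finite S" "\<And>i. i \<in> S \<Longrightarrow> h i \<in> I n"
  shows "cl n (\<Oplus>i\<in>S. h i) = (\<Oplus>\<^bsub>A\<^esub>i\<in>S. cl n (h i))"
  using assms
proof (induction S)
  case (insert a S)
  then show ?case
    using finsum_insert[of S a h] A.finsum_insert[of S a "\<lambda>i. cl n (h i)"] filtration_carrier[of _ n]
    by (simp add: class_add filtration_finsum class_closed Pi_def)
qed (simp add: class_zero filtration_closed)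

text \<open>In the tensor product p (x \<otimes> 1) = x \<otimes> (p 1), and p 1 vanishes in
  Z/p.\<close>

lemma class_char:
  assumes "r \<in> I n"
  shows "cl n (add_pow R p r) = \<zero>\<^bsub>A\<^esub>"
proof -
  define x where "x = gr_embed R I n (I (Suc n) +> r)"
  have x: "x \<in> carrier (gr_ring R I)"
    using assms by (simp add: x_def gr_embed_coset carrier_gr_ring monom_filtered)
  let ?z = "\<lambda>k :: nat. add_pow (ZFact (int p)) k \<one>\<^bsub>ZFact (int p)\<^esub>"
  have zero: "pure_tensor (gr_ring R I) (ZFact (int p)) x \<zero>\<^bsub>ZFact (int p)\<^esub> = \<zero>\<^bsub>A\<^esub>"
    using gr.pure_add_right[OF x, of "\<zero>\<^bsub>ZFact (int p)\<^esub>" "\<zero>\<^bsub>ZFact (int p)\<^esub>"]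
      gr.pure_closed[OF x, of "\<zero>\<^bsub>ZFact (int p)\<^esub>"] by (simp flip: gr_mod_ring_def)
  have "add_pow A k (cl n r) = pure_tensor (gr_ring R I) (ZFact (int p)) x (?z k)" for k :: nat
    by (induction k) (simp_all add: zero gr_mod_class_def gr_mod_ring_def gr.pure_add_right x flip: x_def)
  then show ?thesis
    using assms zero by (simp add: class_add_pow ZFact_add_pow_one)
qed

text \<open>Since 1 generates Z/p additively, every pure tensor comes by differences from tensors x
  \<otimes> 1; these lie in the image, which is closed under differences.\<close>

lemma poly_class_surj: "carrier A = poly_class ` filtered_polys"
proof
  interpret S: cring "UP R\<lparr>carrier := filtered_polys\<rparr>" by (rule filtered_polys_cring)
  interpret h: ring_hom_ring "UP R\<lparr>carrier := filtered_polys\<rparr>" A poly_class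
    by (rule ring_hom_ringI2[OF S.ring_axioms A.ring_axioms poly_class_hom])
  have diff_closed: "x \<ominus>\<^bsub>A\<^esub> y \<in> poly_class ` filtered_polys"
    if xy: "x \<in> poly_class ` filtered_polys" "y \<in> poly_class ` filtered_polys" for x y
  proof -
    obtain f g where fg: "f \<in> filtered_polys" "g \<in> filtered_polys" "x = poly_class f" "y = poly_class g"
      using xy by blast
    then have "x \<ominus>\<^bsub>A\<^esub> y = poly_class (f \<ominus>\<^bsub>UP R\<lparr>carrier := filtered_polys\<rparr>\<^esub> g)"
      using h.hom_add[of f "\<ominus>\<^bsub>UP R\<lparr>carrier := filtered_polys\<rparr>\<^esub> g"] h.hom_a_inv[of g] S.a_inv_closed[of g]
      by (simp add: a_minus_def)
    then show ?thesis
      using S.minus_closed[of f g] fg by auto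
  qed
  show "carrier A \<subseteq> poly_class ` filtered_polys"
  proof
    fix x assume "x \<in> carrier A"
    then show "x \<in> poly_class ` filtered_polys"
      unfolding gr_mod_ring_def
    proof (induction x rule: gr.tensor_induct)
      case (pure a b)
      from pure(2,1) show ?case
      proof (induction b rule: ZFact_induct)
        case one
        then show ?case by (auto simp: carrier_gr_ring poly_class_def)
      next
        case (diff x y)
        have "pure_tensor (gr_ring R I) (ZFact (int p)) a (x \<ominus>\<^bsub>ZFact (int p)\<^esub> y)
          = pure_tensor (gr_ring R I) (ZFact (int p)) a x \<ominus>\<^bsub>A\<^esub> pure_tensor (gr_ring R I) (ZFact (int p)) a y"
          using gr.pure_minus_right diff by (simp add: gr_mod_ring_def)
        then show ?case
          using diff_closed[OF diff(3)[OF diff(5)] diff(4)[OF diff(5)]] by simp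
      qed
    next
      case (diff x y)
      then show ?case using diff_closed by (simp flip: gr_mod_ring_def)
    qed
  qed
  show "poly_class ` filtered_polys \<subseteq> carrier A"
    using h.hom_closed by auto
qed

lemma class_hom: "cl n \<in> hom ((add_monoid R)\<lparr>carrier := I n\<rparr>) (add_monoid A)"
  by (simp add: hom_def class_closed class_add)

lemma class_minus:
  assumes "r \<in> I n" "s \<in> I n"
  shows "cl n (r \<ominus> s) = cl n r \<ominus>\<^bsub>A\<^esub> cl n s"
proof -
  have rs: "r \<ominus> s \<in> I n"
    using assms by (simp add: a_minus_def filtration_closed)
  have "r = (r \<ominus> s) \<oplus> s"
    using assms filtration_carrier[of _ n] by (simp add: minus_eq a_assoc l_neg)
  then have "cl n r = cl n (r \<ominus> s) \<oplus>\<^bsub>A\<^esub> cl n s"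
    using class_add[OF rs assms(2)] by simp
  then show ?thesis
    using class_closed[OF rs] class_closed[OF assms(2)] by (simp add: A.minus_eq A.a_assoc A.r_neg)
qed

text \<open>Every homogeneous element thus lifts to the filtration. As before, the scalar in a pure
  tensor is reduced to 1, and the image of \<open>cl n\<close> is a subgroup.\<close>

lemma gr_mod_piece_eq: "gr_mod_piece p R I n = cl n ` I n"
proof
  show "cl n ` I n \<subseteq> gr_mod_piece p R I n"
    by (auto simp: gr_mod_piece_def gr_mod_class_def carrier_gr_piece intro!: generate.incl)
  interpret n: group_hom "(add_monoid R)\<lparr>carrier := I n\<rparr>" "add_monoid A" "cl n"
    by (intro group_hom.intro group_hom_axioms.intro class_hom A.add.is_group
        comm_group.axioms(2)[OF filtration_comm_group])
  show "gr_mod_piece p R I n \<subseteq> cl n ` I n"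
    unfolding gr_mod_piece_def
  proof (rule A.add.generate_subgroup_incl)
    show "subgroup (cl n ` I n) (add_monoid A)"
      using n.img_is_subgroup by simp
    have "pure_tensor (gr_ring R I) (ZFact (int p)) (gr_embed R I n (I (Suc n) +> r)) z \<in> cl n ` I n"
      if r: "r \<in> I n" and z: "z \<in> carrier (ZFact (int p))" for r z
      using z
    proof (induction z rule: ZFact_induct)
      case one
      then show ?case using r by (auto simp: gr_mod_class_def)
    next
      case (diff y z)
      let ?x = "gr_embed R I n (I (Suc n) +> r)"
      have x: "?x \<in> carrier (gr_ring R I)"
        using r by (simp add: gr_embed_coset carrier_gr_ring monom_filtered)
      obtain s t where st: "s \<in> I n" "t \<in> I n"
          "pure_tensor (gr_ring R I) (ZFact (int p)) ?x y = cl n s"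
          "pure_tensor (gr_ring R I) (ZFact (int p)) ?x z = cl n t"
        using diff(3,4) by blast
      then have "pure_tensor (gr_ring R I) (ZFact (int p)) ?x (y \<ominus>\<^bsub>ZFact (int p)\<^esub> z) = cl n (s \<ominus> t)"
        using gr.pure_minus_right[OF x diff(1,2)] by (simp add: class_minus gr_mod_ring_def)
      moreover have "s \<ominus> t \<in> I n" using st by (simp add: a_minus_def filtration_closed)
      ultimately show ?case by blast
    qed
    then show "{pure_tensor (gr_ring R I) (ZFact (int p)) (gr_embed R I n a) z |a z.
        a \<in> carrier (gr_piece R I n) \<and> z \<in> carrier (ZFact (int p))} \<subseteq> cl n ` I n"
      by (auto simp: carrier_gr_piece)
  qed
qed

text \<open>An element lifts to a polynomial of the Rees algebra, whose coefficients are split off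
  one by one from the top.\<close>

lemma gr_mod_induct [consumes 1, case_names cl add]:
  assumes "x \<in> carrier A"
    and cl: "\<And>n r. r \<in> I n \<Longrightarrow> P (cl n r)"
    and add: "\<And>x y. \<lbrakk>x \<in> carrier A; y \<in> carrier A; P x; P y\<rbrakk> \<Longrightarrow> P (x \<oplus>\<^bsub>A\<^esub> y)"
  shows "P x"
proof -
  have poly: "P (poly_class f)" if "f \<in> filtered_polys" "\<forall>k\<ge>m. f k = \<zero>" for f m
    using that
  proof (induction m arbitrary: f)
    case 0
    \<comment> \<open>The zero polynomial is covered by the case of homogeneous classes, as the
      class of 0 in degree 0.\<close>
    then have "f = monom (UP R) \<zero> 0"
      by (auto simp: UP_def)
    then show ?case
      using cl[of \<zero> 0] by (simp add: class_eq_poly_class filtration_closed)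
  next
    case (Suc m)
    define g where "g = f(m := \<zero>)"
    obtain b where "bound \<zero> b f" using filtered_polysD(1)[OF Suc.prems(1)] by blast
    then have "bound \<zero> b g" by (auto simp: g_def)
    then have "g \<in> up R"
      using filtered_polysD(3)[OF Suc.prems(1)] by (intro mem_upI) (auto simp: g_def)
    then have g: "g \<in> filtered_polys"
      using filtered_polysD(2)[OF Suc.prems(1)] by (auto simp: g_def filtered_polys_def UP_def filtration_closed)
    have fm: "f m \<in> I m" "f k \<in> carrier R" for k by (rule filtered_polysD[OF Suc.prems(1)])+
    have "f = g \<oplus>\<^bsub>UP R\<^esub> monom (UP R) (f m) m"
      using filtered_polysD(1)[OF g] filtered_polysD(1)[OF monom_filtered[OF fm(1)]] fm
      by (auto simp: UP_def g_def fun_eq_iff)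
    then have "poly_class f = poly_class g \<oplus>\<^bsub>A\<^esub> cl m (f m)"
      using ring_hom_add[OF poly_class_hom, of g "monom (UP R) (f m) m"] g monom_filtered[OF fm(1)]
      by (simp add: class_eq_poly_class fm)
    moreover have "P (poly_class g)"
      by (rule Suc.IH[OF g]) (use Suc.prems(2) in \<open>auto simp: g_def Suc_le_eq\<close>)
    ultimately show ?case
      using add[of "poly_class g" "cl m (f m)"] cl[OF fm(1)] class_closed[OF fm(1)] g poly_class_surj by auto
  qed
  obtain f where f: "f \<in> filtered_polys" "x = poly_class f"
    using assms(1) poly_class_surj by blast
  then obtain m where "bound \<zero> m f" using filtered_polysD(1) by blast
  then have "\<forall>k\<ge>Suc m. f k = \<zero>" by (auto simp: Suc_le_eq)
  then show ?thesis using poly f by blast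
qed

text \<open>Each \<open>f n\<close> factors through the graded piece, the factors are summed over
  all degrees, and the sum is extended along the tensor product.\<close>

theorem gr_mod_universal:
  assumes f: "\<And>n. f n \<in> hom ((add_monoid R)\<lparr>carrier := I n\<rparr>) (add_monoid A)"
    and f_zero: "\<And>n r. r \<in> I (Suc n) \<Longrightarrow> f n r = \<zero>\<^bsub>A\<^esub>"
  obtains h where "h \<in> hom (add_monoid A) (add_monoid A)" "\<And>n r. r \<in> I n \<Longrightarrow> h (cl n r) = f n r"
proof -
  have "\<exists>g. g \<in> hom (gr_piece R I n) (add_monoid A) \<and> (\<forall>r\<in>I n. g (I (Suc n) +> r) = f n r)" for n
  proof -
    interpret n: group_hom "(add_monoid R)\<lparr>carrier := I n\<rparr>" "add_monoid A" "f n"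
      by (intro group_hom.intro group_hom_axioms.intro f A.add.is_group
          comm_group.axioms(2)[OF filtration_comm_group])
    have "I (Suc n) \<lhd> (add_monoid R)\<lparr>carrier := I n\<rparr>"
      by (rule comm_group.subgroup_imp_normal[OF filtration_comm_group filtration_subgroup])
    then obtain g where "g \<in> hom ((add_monoid R)\<lparr>carrier := I n\<rparr> Mod I (Suc n)) (add_monoid A)"
      and "\<And>r. r \<in> carrier ((add_monoid R)\<lparr>carrier := I n\<rparr>)
        \<Longrightarrow> g (I (Suc n) #>\<^bsub>(add_monoid R)\<lparr>carrier := I n\<rparr>\<^esub> r) = f n r"
    proof (rule n.FactGroup_universal_kernel)
      show "I (Suc n) \<subseteq> kernel ((add_monoid R)\<lparr>carrier := I n\<rparr>) (add_monoid A) (f n)"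
        using filtration_decreasing[of n] f_zero by (auto simp: kernel_def)
    qed blast
    then show ?thesis
      by (intro exI[of _ g]) (auto simp: gr_piece_def a_r_coset_def r_coset_def)
  qed
  then obtain g where g: "\<And>n. g n \<in> hom (gr_piece R I n) (add_monoid A)"
      and gf: "\<And>n r. r \<in> I n \<Longrightarrow> g n (I (Suc n) +> r) = f n r"
    by metis
  \<comment> \<open>\<open>gfinprod\<close> multiplies over the support only, here finite, so all
    degrees can be summed at once.\<close>
  define G where "G x = gfinprod (add_monoid A) (\<lambda>n. g n (x n)) UNIV" for x
  have G: "G \<in> hom (add_monoid (gr_ring R I)) (add_monoid A)"
  proof -
    have "G \<in> hom (sum_group UNIV (gr_piece R I)) (add_monoid A)"
      unfolding G_def by (rule A.add.hom_group_sum) (use g in auto)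
    then show ?thesis by (simp add: hom_def gr_ring_def)
  qed
  have G_embed: "G (gr_embed R I n (I (Suc n) +> r)) = f n r" if r: "r \<in> I n" for n r
  proof -
    have fr: "f n r \<in> carrier A" using hom_in_carrier[OF f, of r n] r by simp
    have "g m (I (Suc m)) = \<zero>\<^bsub>A\<^esub>" for m
      using gf[of \<zero> m] f_zero[of \<zero> m] by (simp add: coset_zero filtration_closed)
    then have "G (gr_embed R I n (I (Suc n) +> r)) = gfinprod (add_monoid A) (\<lambda>m. if m = n then f n r else \<zero>\<^bsub>A\<^esub>) UNIV"
      unfolding G_def gr_embed_def
      by (intro arg_cong[where f = "\<lambda>h. gfinprod (add_monoid A) h UNIV"]) (simp add: fun_eq_iff gf r)
    also have "\<dots> = gfinprod (add_monoid A) (\<lambda>m. f n r) {n}"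
      by (rule A.add.gfinprod_mono_neutral_cong_right) (use fr in auto)
    also have "\<dots> = f n r"
      using fr A.add.gfinprod_eq_finprod[of "{n}" "\<lambda>m. f n r"] A.finsum_insert[of "{}" n "\<lambda>m. f n r"] by auto
    finally show ?thesis .
  qed
  \<comment> \<open>A scalar z of Z/p acts on \<open>A\<close> as multiplication by 1 \<otimes> z,
    which makes this biadditive; for z = 1 the second factor is the unit of
    \<open>A\<close>.\<close>
  let ?b = "\<lambda>x z. G x \<otimes>\<^bsub>A\<^esub> pure_tensor (gr_ring R I) (ZFact (int p)) \<one>\<^bsub>gr_ring R I\<^esub> z"
  have pz: "pure_tensor (gr_ring R I) (ZFact (int p)) \<one>\<^bsub>gr_ring R I\<^esub> z \<in> carrier A"
    if "z \<in> carrier (ZFact (int p))" for z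
    using gr.pure_closed[OF gr.A.one_closed that] by (simp add: gr_mod_ring_def)
  have Gx: "G x \<in> carrier A" if "x \<in> carrier (gr_ring R I)" for x
    using hom_in_carrier[OF G] that by simp
  have Gadd: "G (x \<oplus>\<^bsub>gr_ring R I\<^esub> y) = G x \<oplus>\<^bsub>A\<^esub> G y"
    if "x \<in> carrier (gr_ring R I)" "y \<in> carrier (gr_ring R I)" for x y
    using hom_mult[OF G, of x y] that by simp
  have padd: "pure_tensor (gr_ring R I) (ZFact (int p)) \<one>\<^bsub>gr_ring R I\<^esub> (y \<oplus>\<^bsub>ZFact (int p)\<^esub> z)
     = pure_tensor (gr_ring R I) (ZFact (int p)) \<one>\<^bsub>gr_ring R I\<^esub> y \<oplus>\<^bsub>A\<^esub>
       pure_tensor (gr_ring R I) (ZFact (int p)) \<one>\<^bsub>gr_ring R I\<^esub> z"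
    if "y \<in> carrier (ZFact (int p))" "z \<in> carrier (ZFact (int p))" for y z
    using gr.pure_add_right[OF gr.A.one_closed that] by (simp add: gr_mod_ring_def)
  obtain h where h: "h \<in> hom (add_monoid (tensor_ring (gr_ring R I) (ZFact (int p)))) (add_monoid A)"
      and hb: "\<And>x z. \<lbrakk>x \<in> carrier (gr_ring R I); z \<in> carrier (ZFact (int p))\<rbrakk>
        \<Longrightarrow> h (pure_tensor (gr_ring R I) (ZFact (int p)) x z) = ?b x z"
    by (rule gr.tensor_universal[where f = ?b, OF A.a_comm_group])
      (auto simp: hom_def A.l_distr A.r_distr Gx pz Gadd padd)
  show thesis
  proof (rule that[OF h[folded gr_mod_ring_def]])
    fix n r assume r: "r \<in> I n"
    have x: "gr_embed R I n (I (Suc n) +> r) \<in> carrier (gr_ring R I)"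
      using r by (simp add: gr_embed_coset carrier_gr_ring monom_filtered)
    have "h (cl n r) = f n r \<otimes>\<^bsub>A\<^esub> \<one>\<^bsub>A\<^esub>"
      using hb[OF x gr.B.one_closed] gr.pure_one G_embed[OF r] by (simp add: gr_mod_class_def flip: gr_mod_ring_def)
    then show "h (cl n r) = f n r"
      using hom_in_carrier[OF f, of r n] r by simp
  qed
qed

end

section \<open>Operations from Atiyah formulas\<close>

context cring
begin

lemma add_pow_finsum:
  "f \<in> S \<rightarrow> carrier R \<Longrightarrow> add_pow R (k :: nat) (\<Oplus>i\<in>S. f i) = (\<Oplus>i\<in>S. add_pow R k (f i))"
proof (induction S rule: infinite_finite_induct)
  case (insert a S)
  then show ?case
    by (subst (1 2) finsum_insert) (auto simp: add.nat_pow_distrib)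
qed (auto simp: add.nat_pow_one)

lemma binomial_expansion:
  assumes [simp]: "x \<in> carrier R" "y \<in> carrier R"
  shows "(x \<oplus> y) [^] (n :: nat) = (\<Oplus>k\<in>{..n}. add_pow R (n choose k) (x [^] k \<otimes> y [^] (n - k)))"
proof (induction n)
  case 0
  show ?case by simp
next
  case (Suc n)
  define t where "t k = x [^] k \<otimes> y [^] (Suc n - k)" for k
  have t: "t k \<in> carrier R" for k by (simp add: t_def)
  have sx: "x [^] k \<otimes> y [^] (n - k) \<otimes> x = t (Suc k)" for k
    by (simp add: t_def m_ac)
  have sy: "x [^] k \<otimes> y [^] (n - k) \<otimes> y = t k" if "k \<le> n" for k
    using that by (simp add: t_def m_ac Suc_diff_le)
  let ?S = "\<lambda>c. \<Oplus>k\<in>{..n}. add_pow R (n choose k) (t (c k))"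
  have "(x \<oplus> y) [^] Suc n = (\<Oplus>k\<in>{..n}. add_pow R (n choose k) (x [^] k \<otimes> y [^] (n - k))) \<otimes> x
      \<oplus> (\<Oplus>k\<in>{..n}. add_pow R (n choose k) (x [^] k \<otimes> y [^] (n - k))) \<otimes> y"
    by (simp add: Suc r_distr)
  also have "\<dots> = ?S Suc \<oplus> ?S (\<lambda>k. k)"
    by (simp add: finsum_ldistr add_pow_ldistr sx sy t cong: finsum_cong)
  \<comment> \<open>The added term has coefficient n choose n + 1, which is 0. Splitting off index 0
    instead then aligns both sums for the rule of Pascal.\<close>
  also have "?S (\<lambda>k. k) = (\<Oplus>k\<in>{..Suc n}. add_pow R (n choose k) (t k))"
    using t by (simp add: binomial_eq_0)
  also have "\<dots> = (\<Oplus>k\<in>{..n}. add_pow R (n choose Suc k) (t (Suc k))) \<oplus> t 0"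
    using t by (subst finsum_Suc2) simp_all
  also have "?S Suc \<oplus> \<dots> = (?S Suc \<oplus> (\<Oplus>k\<in>{..n}. add_pow R (n choose Suc k) (t (Suc k)))) \<oplus> t 0"
    using t by (intro a_assoc[symmetric]) auto
  also have "?S Suc \<oplus> (\<Oplus>k\<in>{..n}. add_pow R (n choose Suc k) (t (Suc k)))
      = (\<Oplus>k\<in>{..n}. add_pow R (n choose k) (t (Suc k)) \<oplus> add_pow R (n choose Suc k) (t (Suc k)))"
    using t by (intro finsum_addf[symmetric]) auto
  also have "\<dots> = (\<Oplus>k\<in>{..n}. add_pow R (Suc n choose Suc k) (t (Suc k)))"
    using t by (simp add: add.nat_pow_mult)
  also have "(\<Oplus>k\<in>{..n}. add_pow R (Suc n choose Suc k) (t (Suc k))) \<oplus> t 0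
      = (\<Oplus>k\<in>{..Suc n}. add_pow R (Suc n choose k) (t k))"
    using t by (subst finsum_Suc2) simp_all
  finally show ?case by (simp add: t_def)
qed

end

context filtered_algebra
begin

text \<open>The inner binomial coefficients are divisible by p, and every monomial of degree p in x
  and y lies in \<open>I (p * n)\<close>, hence so does h.\<close>

lemma filtration_frobenius:
  assumes p: "prime p" and xy: "x \<in> I n" "y \<in> I n"
  obtains h where "h \<in> I (p * n)" "(x \<oplus> y) [^] p = x [^] p \<oplus> y [^] p \<oplus> add_pow R p h"
proof -
  have xyR: "x \<in> carrier R" "y \<in> carrier R" using xy filtration_carrier by auto
  define t where "t k = x [^] k \<otimes> y [^] (p - k)" for k
  have t: "t k \<in> I (p * n)" if "k \<le> p" for k
    using filtration_mult[OF filtration_pow[OF xy(1), of k] filtration_pow[OF xy(2), of "p - k"]] that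
    by (simp add: t_def flip: add_mult_distrib)
  have tR: "t k \<in> carrier R" for k using xyR by (simp add: t_def)
  define h where "h = (\<Oplus>k\<in>{0<..<p}. add_pow R ((p choose k) div p) (t k))"
  have "add_pow R (p choose k) (t k) = add_pow R p (add_pow R ((p choose k) div p) (t k))"
    if "k \<in> {0<..<p}" for k
    using that tR dvd_choose_prime[of k p] p by (simp add: add.nat_pow_pow)
  then have h: "(\<Oplus>k\<in>{0<..<p}. add_pow R (p choose k) (t k)) = add_pow R p h"
    using tR by (simp add: h_def add_pow_finsum cong: finsum_cong)
  have p0: "0 < p" using p prime_gt_0_nat by simp
  then have "{..p} = insert 0 (insert p {0<..<p})" by auto
  then have "(x \<oplus> y) [^] p = t 0 \<oplus> (t p \<oplus> add_pow R p h)"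
    using p0 tR h by (simp add: binomial_expansion xyR flip: t_def)
  moreover have "t 0 = y [^] p" "t p = x [^] p"
    using xyR by (simp_all add: t_def)
  moreover have "h \<in> I (p * n)"
    unfolding h_def by (intro filtration_finsum filtration_add_pow t) simp
  ultimately show thesis
    using that[of h] xyR filtration_carrier[of h] by (simp add: a_ac)
qed

end

section \<open>Lax Atiyah formulas and the uniqueness of their classes\<close>

locale prime_psi_algebra = pre_psi_algebra +
  assumes prime_p: "prime p"
begin

sublocale filtered_algebra_mod R I p
  by unfold_locales

lemma p_pos: "0 < p"
  using prime_p prime_gt_0_nat by blast

text \<open>A lax formula only asks for the top term to be \<open>r\<^sup>p\<close> up to a multiple of \<open>p\<close>. Unlike Atiyah
  formulas, lax formulas are closed under termwise addition and Cauchy product, and \<open>q = 0\<close> is no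
  longer special.\<close>

definition lax_formula :: "nat \<Rightarrow> 'a \<Rightarrow> (nat \<Rightarrow> 'a) \<Rightarrow> bool" where
  "lax_formula q r f \<longleftrightarrow>
     (\<forall>i. f i \<in> I (2 * q + 2 * i * (p - 1))) \<and>
     (\<forall>i>q. f i = \<zero>) \<and>
     (\<exists>u \<in> I (p * (2 * q)). f q = r [^] p \<oplus> add_pow R p u) \<and>
     \<psi> r = (\<Oplus>i\<in>{..q}. add_pow R (p ^ (q - i)) (f i))"

lemma top_degree: "2 * q + 2 * q * (p - 1) = p * (2 * q)"
  using p_pos by (cases p) (simp_all add: algebra_simps)

text \<open>For fixed k all products \<open>f i\<close> times \<open>g (k - i)\<close> belong to one
  degree, so Cauchy products of formulas are homogeneous termwise.\<close>

lemma degree_add: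
  assumes "i \<le> k"
  shows "2 * q + 2 * i * (p - 1) + (2 * t + 2 * (k - i) * (p - 1)) = 2 * (q + t) + 2 * k * (p - 1)"
proof -
  have "2 * q + 2 * i * (p - 1) + (2 * t + 2 * (k - i) * (p - 1)) = 2 * (q + t) + 2 * (i + (k - i)) * (p - 1)"
    by (simp add: algebra_simps)
  then show ?thesis using assms by simp
qed

lemma lax_formulaD:
  assumes "lax_formula q r f"
  shows "f i \<in> I (2 * q + 2 * i * (p - 1))" "i > q \<Longrightarrow> f i = \<zero>" "f i \<in> carrier R"
    "\<psi> r = (\<Oplus>i\<in>{..q}. add_pow R (p ^ (q - i)) (f i))"
  using assms filtration_carrier unfolding lax_formula_def by blast+

lemma lax_formula_top:
  assumes "lax_formula q r f"
  obtains u where "u \<in> I (p * (2 * q))" "f q = r [^] p \<oplus> add_pow R p u"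
  using assms unfolding lax_formula_def by blast

text \<open>The values beyond q, which an Atiyah formula leaves free, are set to zero; Cauchy
  products then need no truncation. The excess at the top is 0.\<close>

lemma atiyah_imp_lax:
  assumes r: "r \<in> I (2 * q)" and "atiyah_formula p R I \<psi> q r f"
  shows "lax_formula q r (\<lambda>i. if i \<le> q then f i else \<zero>)"
proof -
  have "(\<Oplus>i\<in>{..q}. add_pow R (p ^ (q - i)) (if i \<le> q then f i else \<zero>))
      = (\<Oplus>i\<in>{..q}. add_pow R (p ^ (q - i)) (f i))"
    by (rule finsum_cong') (use assms(2) filtration_carrier in \<open>auto simp: atiyah_formula_def\<close>)
  moreover have "r [^] p = r [^] p \<oplus> add_pow R p \<zero>"
    using filtration_carrier[OF r] by simp
  ultimately show ?thesis
    using assms(2) unfolding lax_formula_def atiyah_formula_def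
    by (auto intro!: filtration_closed bexI[of _ \<zero>])
qed

text \<open>In filtration 0 the single term is r^p + p r', with r' as the excess; this absorbs the
  special case q = 0.\<close>

lemma lax_formula_exists:
  assumes "r \<in> I (2 * q)"
  obtains f where "lax_formula q r f"
proof (cases "q = 0")
  case True
  then obtain r' where "atiyah_formula_zero p R \<psi> r r'"
    using assms atiyah_zero by auto
  then have r': "r' \<in> carrier R" "\<psi> r = add_pow R p r' \<oplus> r [^] p"
    by (auto simp: atiyah_formula_zero_def)
  have "lax_formula 0 r (\<lambda>i. if i = 0 then r [^] p \<oplus> add_pow R p r' else \<zero>)"
    using r' assms True
    by (auto simp: lax_formula_def filtration_zero filtration_closed a_comm intro!: bexI[of _ r'])
  then show thesis using that True by blast
next
  case False
  then show thesis
    using atiyah_pos[of q r] assms atiyah_imp_lax that by blast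
qed

text \<open>The excess is a multiple of p in the right filtration, so its class vanishes.\<close>

lemma lax_formula_class_top:
  assumes r: "r \<in> I (2 * q)" and f: "lax_formula q r f"
  shows "cl (2 * q + 2 * q * (p - 1)) (f q) = cl (p * (2 * q)) (r [^] p)"
proof -
  obtain u where u: "u \<in> I (p * (2 * q))" "f q = r [^] p \<oplus> add_pow R p u"
    using f by (rule lax_formula_top)
  then show ?thesis
    using class_closed[OF filtration_pow[OF r]] class_char[OF u(1)]
    unfolding top_degree by (simp add: class_add filtration_pow r filtration_add_pow)
qed

text \<open>The excess term \<open>p u\<close> at the top is moved one place down, where it lies in a higher
  filtration than required and so does not change the class.\<close>

lemma lax_imp_atiyah:
  assumes r: "r \<in> I (2 * q)" and "q > 0" and f: "lax_formula q r f"
  obtains g where "atiyah_formula p R I \<psi> q r g"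
    and "\<And>i. i \<le> q \<Longrightarrow> cl (2 * q + 2 * i * (p - 1)) (f i) = cl (2 * q + 2 * i * (p - 1)) (g i)"
proof -
  obtain m where q: "q = Suc m" using \<open>q > 0\<close> gr0_conv_Suc by blast
  obtain u where u: "u \<in> I (p * (2 * q))" "f q = r [^] p \<oplus> add_pow R p u"
    using f by (rule lax_formula_top)
  define g where "g = f(q := r [^] p, m := f m \<oplus> u)"
  note fD = lax_formulaD[OF f]
  have rR: "r \<in> carrier R" "r [^] p \<in> I (p * (2 * q))" and uR: "u \<in> carrier R"
    using r u filtration_carrier filtration_pow by auto
  \<comment> \<open>Consecutive terms differ by 2 (p - 1) in degree, which is positive as p is at
    least 2.\<close>
  have "Suc (2 * q + 2 * m * (p - 1)) \<le> p * (2 * q)"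
    unfolding top_degree[symmetric] q using prime_ge_2_nat[OF prime_p] by simp
  then have um: "u \<in> I (Suc (2 * q + 2 * m * (p - 1)))"
    using u(1) filtration_antimono by blast
  then have um': "u \<in> I (2 * q + 2 * m * (p - 1))"
    using filtration_decreasing by blast
  have g: "g i \<in> I (2 * q + 2 * i * (p - 1))" for i
    using fD(1)[of i] rR(2)[folded top_degree] um' by (auto simp: g_def filtration_closed)
  have split: "{..q} = insert q (insert m {..<m})"
    unfolding q by auto
  have "(\<Oplus>i\<in>{..q}. add_pow R (p ^ (q - i)) (f i)) = f q \<oplus> (add_pow R p (f m) \<oplus>
      (\<Oplus>i\<in>{..<m}. add_pow R (p ^ (q - i)) (f i)))"
    unfolding split using fD(3) by (simp add: q Pi_def)
  also have "\<dots> = g q \<oplus> (add_pow R p (g m) \<oplus> (\<Oplus>i\<in>{..<m}. add_pow R (p ^ (q - i)) (f i)))"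
    using fD(3)[of m] rR(1) uR fD(3)
    by (simp add: u(2)[unfolded q] g_def q a_ac add.nat_pow_distrib finsum_closed Pi_def)
  also have "(\<Oplus>i\<in>{..<m}. add_pow R (p ^ (q - i)) (f i)) = (\<Oplus>i\<in>{..<m}. add_pow R (p ^ (q - i)) (g i))"
    by (rule finsum_cong') (use fD(3) q in \<open>auto simp: g_def\<close>)
  also have "g q \<oplus> (add_pow R p (g m) \<oplus> (\<Oplus>i\<in>{..<m}. add_pow R (p ^ (q - i)) (g i)))
      = (\<Oplus>i\<in>{..q}. add_pow R (p ^ (q - i)) (g i))"
    unfolding split using filtration_carrier[OF g] by (simp add: q Pi_def)
  finally have "atiyah_formula p R I \<psi> q r g"
    using g fD(4) by (simp add: atiyah_formula_def) (simp add: g_def q)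
  moreover have "cl (2 * q + 2 * i * (p - 1)) (f i) = cl (2 * q + 2 * i * (p - 1)) (g i)" if "i \<le> q" for i
  proof -
    consider "i = q" | "i = m" | "i \<noteq> q" "i \<noteq> m" by blast
    then show ?thesis
    proof cases
      case 1
      moreover have "g q = r [^] p" by (simp add: g_def q)
      ultimately show ?thesis
        using lax_formula_class_top[OF r f] by (simp only: top_degree)
    next
      case 2
      then show ?thesis
        using class_add[OF fD(1)[of m] um'] class_zero[OF um] class_closed[OF fD(1)[of m]]
        by (simp add: g_def q)
    qed (simp add: g_def)
  qed
  ultimately show thesis by (rule that)
qed

text \<open>For positive q both formulas are replaced by Atiyah formulas with the same classes, to
  which the uniqueness axiom applies. For q = 0 only the top term is left, and its class is that of
  r^p.\<close>

lemma lax_formula_unique: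
  assumes r: "r \<in> I (2 * q)" and f: "lax_formula q r f" and g: "lax_formula q r g"
  shows "cl (2 * q + 2 * i * (p - 1)) (f i) = cl (2 * q + 2 * i * (p - 1)) (g i)"
proof (cases "i \<le> q")
  case False
  then show ?thesis using lax_formulaD(2)[OF f] lax_formulaD(2)[OF g] by simp
next
  case i: True
  show ?thesis
  proof (cases "q = 0")
    case True
    then show ?thesis
      using lax_formula_class_top[OF r f] lax_formula_class_top[OF r g] i by simp
  next
    case False
    then obtain f' g' where "atiyah_formula p R I \<psi> q r f'" "atiyah_formula p R I \<psi> q r g'"
        "cl (2 * q + 2 * i * (p - 1)) (f i) = cl (2 * q + 2 * i * (p - 1)) (f' i)"
        "cl (2 * q + 2 * i * (p - 1)) (g i) = cl (2 * q + 2 * i * (p - 1)) (g' i)"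
      using lax_imp_atiyah[OF r _ f] lax_imp_atiyah[OF r _ g] i by (metis neq0_conv)
    then show ?thesis
      using atiyah_unique[of q r f' g' i] False r i by simp
  qed
qed

section \<open>The operations on elements of R\<close>

definition psi_op :: "nat \<Rightarrow> nat \<Rightarrow> 'a \<Rightarrow> 'a gr_mod" where
  "psi_op i q r = cl (2 * q + 2 * i * (p - 1)) ((SOME f. lax_formula q r f) i)"

text \<open>By uniqueness of classes the formula chosen in the definition can be exchanged for any
  other, so each property below may use the most convenient one.\<close>

lemma psi_op_eq:
  assumes "r \<in> I (2 * q)" "lax_formula q r f"
  shows "psi_op i q r = cl (2 * q + 2 * i * (p - 1)) (f i)"
  unfolding psi_op_def by (rule lax_formula_unique[OF assms(1) someI[of "lax_formula q r", OF assms(2)] assms(2)])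

lemma psi_op_in_piece: "r \<in> I (2 * q) \<Longrightarrow> psi_op i q r \<in> gr_mod_piece p R I (2 * q + 2 * i * (p - 1))"
  using lax_formula_exists[of r q] psi_op_eq[of r q _ i] lax_formulaD(1)[of q r _ i]
  by (metis gr_mod_piece_eq imageI)

lemma psi_op_closed: "r \<in> I (2 * q) \<Longrightarrow> psi_op i q r \<in> carrier A"
  using psi_op_in_piece[of r q i] class_closed by (auto simp: gr_mod_piece_eq)

lemma psi_op_above: "\<lbrakk>r \<in> I (2 * q); i > q\<rbrakk> \<Longrightarrow> psi_op i q r = \<zero>\<^bsub>A\<^esub>"
  using lax_formula_exists[of r q] psi_op_eq[of r q _ i] lax_formulaD(2)[of q r _ i]
  by (metis class_zero filtration_closed(1))

lemma psi_op_top: "r \<in> I (2 * q) \<Longrightarrow> psi_op q q r = cl (2 * q) r [^]\<^bsub>A\<^esub> p"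
  using lax_formula_exists[of r q] psi_op_eq[of r q _ q] lax_formula_class_top[of r q]
  by (metis class_pow)

lemma psi_op_atiyah:
  assumes "r \<in> I (2 * q)" "atiyah_formula p R I \<psi> q r f"
  shows "psi_op i q r = (if i \<le> q then cl (2 * q + 2 * i * (p - 1)) (f i) else \<zero>\<^bsub>A\<^esub>)"
  using psi_op_eq[OF assms(1) atiyah_imp_lax[OF assms], of i] psi_op_above[OF assms(1), of i] by auto

lemma lax_formula_add:
  assumes r: "r \<in> I (2 * q)" and s: "s \<in> I (2 * q)"
    and f: "lax_formula q r f" and g: "lax_formula q s g"
  shows "lax_formula q (r \<oplus> s) (\<lambda>i. f i \<oplus> g i)"
  unfolding lax_formula_def
proof (intro conjI allI impI)
  note rs = filtration_carrier[OF r] filtration_carrier[OF s]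
  note fD = lax_formulaD[OF f] and gD = lax_formulaD[OF g]
  show "f i \<oplus> g i \<in> I (2 * q + 2 * i * (p - 1))" for i
    using fD gD filtration_closed by simp
  show "f i \<oplus> g i = \<zero>" if "q < i" for i
    using fD(2) gD(2) that by simp
  have "(\<Oplus>i\<in>{..q}. add_pow R (p ^ (q - i)) (f i \<oplus> g i))
      = (\<Oplus>i\<in>{..q}. add_pow R (p ^ (q - i)) (f i)) \<oplus> (\<Oplus>i\<in>{..q}. add_pow R (p ^ (q - i)) (g i))"
    using fD(3) gD(3) by (simp add: add.nat_pow_distrib finsum_addf Pi_def)
  then show "\<psi> (r \<oplus> s) = (\<Oplus>i\<in>{..q}. add_pow R (p ^ (q - i)) (f i \<oplus> g i))"
    using ring_hom_add[OF psi_hom rs] fD(4) gD(4) by simp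
  obtain u v where u: "u \<in> I (p * (2 * q))" "f q = r [^] p \<oplus> add_pow R p u"
      and v: "v \<in> I (p * (2 * q))" "g q = s [^] p \<oplus> add_pow R p v"
    using f g lax_formula_top by metis
  obtain h where h: "h \<in> I (p * (2 * q))" "(r \<oplus> s) [^] p = r [^] p \<oplus> s [^] p \<oplus> add_pow R p h"
    using filtration_frobenius[OF prime_p r s] .
  note uvh = u(1)[THEN filtration_carrier] v(1)[THEN filtration_carrier] h(1)[THEN filtration_carrier]
  \<comment> \<open>The excess for r + s is u + v - h, where -h corrects r^p + s^p to (r +
    s)^p.\<close>
  have "add_pow R p h \<oplus> add_pow R p (u \<oplus> v \<oplus> \<ominus> h) = add_pow R p (u \<oplus> v)"
  proof -
    have "h \<oplus> (u \<oplus> v \<oplus> \<ominus> h) = u \<oplus> v" using uvh by algebra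
    then show ?thesis using uvh by (simp flip: add.nat_pow_distrib)
  qed
  then have "(r \<oplus> s) [^] p \<oplus> add_pow R p (u \<oplus> v \<oplus> \<ominus> h)
      = r [^] p \<oplus> s [^] p \<oplus> add_pow R p (u \<oplus> v)"
    unfolding h(2) using uvh rs by (simp add: a_assoc)
  also have "\<dots> = f q \<oplus> g q"
    unfolding u(2) v(2) using uvh rs by (simp add: a_ac add.nat_pow_distrib)
  finally show "\<exists>u\<in>I (p * (2 * q)). f q \<oplus> g q = (r \<oplus> s) [^] p \<oplus> add_pow R p u"
    using u(1) v(1) h(1) by (intro bexI[of _ "u \<oplus> v \<oplus> \<ominus> h"]) (simp_all add: filtration_closed)
qed

lemma psi_op_add:
  assumes "r \<in> I (2 * q)" "s \<in> I (2 * q)"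
  shows "psi_op i q (r \<oplus> s) = psi_op i q r \<oplus>\<^bsub>A\<^esub> psi_op i q s"
proof -
  obtain f g where fg: "lax_formula q r f" "lax_formula q s g"
    using assms lax_formula_exists by metis
  then show ?thesis
    using psi_op_eq[OF filtration_closed(2)[OF assms] lax_formula_add[OF assms fg], of i]
      class_add[OF lax_formulaD(1)[OF fg(1), of i] lax_formulaD(1)[OF fg(2), of i]] assms
    by (simp add: psi_op_eq)
qed

lemma psi_op_zero:
  assumes "r \<in> I (2 * q + 2)"
  shows "psi_op i q r = \<zero>\<^bsub>A\<^esub>"
proof -
  have "r \<in> I (2 * Suc q)" using assms by simp
  then obtain f where f: "lax_formula (Suc q) r f" by (rule lax_formula_exists)
  note fD = lax_formulaD[OF f]
  obtain u where u: "u \<in> I (p * (2 * Suc q))" "f (Suc q) = r [^] p \<oplus> add_pow R p u"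
    using f by (rule lax_formula_top)
  have r: "r \<in> carrier R" "r \<in> I (2 * q)" and uR: "u \<in> carrier R"
    using assms u(1) filtration_carrier filtration_antimono[of "2 * q" "2 * q + 2"] by auto
  \<comment> \<open>Each coefficient p^(q+1-i) gives up one factor p to its term; the last two terms
    are merged into one, of index q.\<close>
  define g where "g i = (if i < q then add_pow R p (f i)
      else if i = q then add_pow R p (f q) \<oplus> f (Suc q) else \<zero>)" for i
  \<comment> \<open>Relative to q the terms sit two filtrations higher than demanded; one step
    suffices for their classes to vanish.\<close>
  have f_up: "f i \<in> I (Suc (2 * q + 2 * i * (p - 1)))" for i
    using fD(1)[of i] filtration_antimono[of "Suc (2 * q + 2 * i * (p - 1))" "2 * Suc q + 2 * i * (p - 1)"] by auto
  have "f (Suc q) \<in> I (Suc (2 * q + 2 * q * (p - 1)))"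
    using fD(1)[of "Suc q"] filtration_antimono[of "Suc (2 * q + 2 * q * (p - 1))" "2 * Suc q + 2 * Suc q * (p - 1)"] by auto
  then have g: "g i \<in> I (Suc (2 * q + 2 * i * (p - 1)))" for i
    using f_up by (auto simp: g_def filtration_closed filtration_add_pow)
  have "lax_formula q r g"
    unfolding lax_formula_def
  proof (intro conjI allI impI)
    show "g i \<in> I (2 * q + 2 * i * (p - 1))" for i
      using g filtration_decreasing by blast
    show "g i = \<zero>" if "q < i" for i using that by (simp add: g_def)
    have "f q \<in> I (p * (2 * q))"
      using f_up[of q] filtration_decreasing unfolding top_degree by blast
    moreover have "u \<in> I (p * (2 * q))"
      using u(1) filtration_antimono[of "p * (2 * q)" "p * (2 * Suc q)"] by auto
    \<comment> \<open>The top term is p \<open>f q\<close> + r^p + p u, hence of lax form with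
      excess \<open>f q\<close> + u.\<close>
    moreover have "g q = r [^] p \<oplus> add_pow R p (f q \<oplus> u)"
      using fD(3)[of q] uR r(1) by (simp add: g_def u(2) add.nat_pow_distrib a_ac)
    ultimately show "\<exists>u\<in>I (p * (2 * q)). g q = r [^] p \<oplus> add_pow R p u"
      using filtration_closed(2) by blast
    have s1: "{..Suc q} = insert (Suc q) (insert q {..<q})" and s2: "{..q} = insert q {..<q}" by auto
    have "\<psi> r = f (Suc q) \<oplus> (add_pow R p (f q) \<oplus> (\<Oplus>i\<in>{..<q}. add_pow R (p ^ (Suc q - i)) (f i)))"
      unfolding fD(4) s1 using fD(3) by (simp add: Pi_def)
    also have "(\<Oplus>i\<in>{..<q}. add_pow R (p ^ (Suc q - i)) (f i)) = (\<Oplus>i\<in>{..<q}. add_pow R (p ^ (q - i)) (g i))"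
      by (rule finsum_cong') (use fD(3) in \<open>auto simp: g_def add.nat_pow_pow Suc_diff_le\<close>)
    also have "f (Suc q) \<oplus> (add_pow R p (f q) \<oplus> (\<Oplus>i\<in>{..<q}. add_pow R (p ^ (q - i)) (g i)))
        = g q \<oplus> (\<Oplus>i\<in>{..<q}. add_pow R (p ^ (q - i)) (g i))"
      using fD(3) filtration_carrier[OF g] by (simp add: g_def[of q] a_ac finsum_closed Pi_def)
    also have "\<dots> = (\<Oplus>i\<in>{..q}. add_pow R (p ^ (q - i)) (g i))"
      unfolding s2 using filtration_carrier[OF g] by (simp add: Pi_def)
    finally show "\<psi> r = (\<Oplus>i\<in>{..q}. add_pow R (p ^ (q - i)) (g i))" .
  qed
  then show ?thesis
    using psi_op_eq[OF r(2)] class_zero[OF g] by simp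
qed

lemma lax_formula_mult:
  assumes r: "r \<in> I (2 * q)" and s: "s \<in> I (2 * t)"
    and f: "lax_formula q r f" and g: "lax_formula t s g"
  shows "lax_formula (q + t) (r \<otimes> s) (\<lambda>k. \<Oplus>i\<in>{..k}. f i \<otimes> g (k - i))"
  unfolding lax_formula_def
proof (intro conjI allI impI)
  note rs = filtration_carrier[OF r] filtration_carrier[OF s]
  note fD = lax_formulaD[OF f] and gD = lax_formulaD[OF g]
  have fg: "f i \<otimes> g (k - i) \<in> I (2 * (q + t) + 2 * k * (p - 1))" if "i \<le> k" for i k
    using filtration_mult[OF fD(1)[of i] gD(1)[of "k - i"]] unfolding degree_add[OF that] .
  show "(\<Oplus>i\<in>{..k}. f i \<otimes> g (k - i)) \<in> I (2 * (q + t) + 2 * k * (p - 1))" for k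
    by (rule filtration_finsum) (use fg in auto)
  \<comment> \<open>The products outside the rectangle of indices vanish. There the truncated
    exponents q - i and t - (k - i) would not add up to q + t - k.\<close>
  have fg0: "f i \<otimes> g (k - i) = \<zero>" if "q < i \<or> t < k - i" for i k
    using that fD(2,3) gD(2,3) by auto
  show "(\<Oplus>i\<in>{..k}. f i \<otimes> g (k - i)) = \<zero>" if "q + t < k" for k
    using that by (intro add.finprod_one_eqI fg0) auto
  have "\<psi> (r \<otimes> s) = (\<Oplus>i\<in>{..q}. add_pow R (p ^ (q - i)) (f i)) \<otimes> (\<Oplus>i\<in>{..t}. add_pow R (p ^ (t - i)) (g i))"
    using ring_hom_mult[OF psi_hom rs] fD(4) gD(4) by simp
  also have "\<dots> = (\<Oplus>k\<in>{..q + t}. \<Oplus>i\<in>{..k}. add_pow R (p ^ (q - i)) (f i) \<otimes> add_pow R (p ^ (t - (k - i))) (g (k - i)))"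
    by (rule cauchy_product[symmetric]) (use fD gD in \<open>auto intro!: bound.intro\<close>)
  also have "\<dots> = (\<Oplus>k\<in>{..q + t}. add_pow R (p ^ (q + t - k)) (\<Oplus>i\<in>{..k}. f i \<otimes> g (k - i)))"
  proof (rule finsum_cong'[OF refl])
    fix k assume k: "k \<in> {..q + t}"
    have "add_pow R (p ^ (q - i)) (f i) \<otimes> add_pow R (p ^ (t - (k - i))) (g (k - i))
        = add_pow R (p ^ (q + t - k)) (f i \<otimes> g (k - i))" if "i \<in> {..k}" for i
    proof (cases "q < i \<or> t < k - i")
      case True
      then show ?thesis
        using fg0[OF True] fD(2,3) gD(2,3) by auto
    next
      case False
      then have "q - i + (t - (k - i)) = q + t - k" using that k by auto
      then show ?thesis
        using fD(3) gD(3) by (simp add: add_pow_ldistr add_pow_rdistr add.nat_pow_pow flip: power_add)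
    qed
    then show "(\<Oplus>i\<in>{..k}. add_pow R (p ^ (q - i)) (f i) \<otimes> add_pow R (p ^ (t - (k - i))) (g (k - i)))
        = add_pow R (p ^ (q + t - k)) (\<Oplus>i\<in>{..k}. f i \<otimes> g (k - i))"
      using fD(3) gD(3) by (simp add: add_pow_finsum cong: finsum_cong)
  qed (use fD(3) gD(3) in auto)
  finally show "\<psi> (r \<otimes> s) = (\<Oplus>k\<in>{..q + t}. add_pow R (p ^ (q + t - k)) (\<Oplus>i\<in>{..k}. f i \<otimes> g (k - i)))" .
  obtain u v where u: "u \<in> I (p * (2 * q))" "f q = r [^] p \<oplus> add_pow R p u"
      and v: "v \<in> I (p * (2 * t))" "g t = s [^] p \<oplus> add_pow R p v"
    using f g lax_formula_top by metis
  note uv = u(1)[THEN filtration_carrier] v(1)[THEN filtration_carrier]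
  \<comment> \<open>The excess read off from (r^p + p u)(s^p + p v) = (r s)^p + p (u s^p + r^p v + p
    u v).\<close>
  define w where "w = u \<otimes> s [^] p \<oplus> (r [^] p \<otimes> v \<oplus> u \<otimes> add_pow R p v)"
  \<comment> \<open>At the top index any i other than q pushes one of the two factors beyond its
    range.\<close>
  have "(\<Oplus>i\<in>{..q + t}. f i \<otimes> g (q + t - i)) = (\<Oplus>i\<in>{..q + t}. if q = i then f i \<otimes> g (q + t - i) else \<zero>)"
  proof (rule finsum_cong'[OF refl])
    fix i assume "i \<in> {..q + t}"
    then show "f i \<otimes> g (q + t - i) = (if q = i then f i \<otimes> g (q + t - i) else \<zero>)"
      using fg0[of i "q + t"] by (cases "q < i") auto
  qed (use fD(3) gD(3) in auto)
  also have "\<dots> = f q \<otimes> g t"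
    using finsum_singleton[of q "{..q + t}" "\<lambda>i. f i \<otimes> g (q + t - i)"] fD(3) gD(3) by auto
  also have "\<dots> = (r \<otimes> s) [^] p \<oplus> add_pow R p w"
    unfolding u(2) v(2) w_def using uv rs
    by (simp add: l_distr r_distr nat_pow_distrib add.nat_pow_distrib add_pow_ldistr add_pow_rdistr a_ac)
  finally have "(\<Oplus>i\<in>{..q + t}. f i \<otimes> g (q + t - i)) = (r \<otimes> s) [^] p \<oplus> add_pow R p w" .
  moreover have "w \<in> I (p * (2 * (q + t)))"
  proof -
    have "p * (2 * (q + t)) = p * (2 * q) + p * (2 * t)" by (simp add: algebra_simps)
    then show ?thesis
      unfolding w_def using u(1) v(1) filtration_pow[OF r, of p] filtration_pow[OF s, of p]
      by (auto intro!: filtration_closed(2) filtration_mult filtration_add_pow)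
  qed
  ultimately show "\<exists>u\<in>I (p * (2 * (q + t))). (\<Oplus>i\<in>{..q + t}. f i \<otimes> g (q + t - i)) = (r \<otimes> s) [^] p \<oplus> add_pow R p u"
    by blast
qed

lemma psi_op_mult:
  assumes r: "r \<in> I (2 * q)" and s: "s \<in> I (2 * t)"
  shows "psi_op k (q + t) (r \<otimes> s) = (\<Oplus>\<^bsub>A\<^esub>l\<in>{..k}. psi_op l q r \<otimes>\<^bsub>A\<^esub> psi_op (k - l) t s)"
proof -
  obtain f g where f: "lax_formula q r f" and g: "lax_formula t s g"
    using r s lax_formula_exists by metis
  note fD = lax_formulaD[OF f] and gD = lax_formulaD[OF g]
  have rs: "r \<otimes> s \<in> I (2 * (q + t))" using filtration_mult[OF r s] by (simp add: algebra_simps)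
  have prod: "psi_op i q r \<otimes>\<^bsub>A\<^esub> psi_op (k - i) t s = cl (2 * (q + t) + 2 * k * (p - 1)) (f i \<otimes> g (k - i))"
    if "i \<le> k" for i
    using class_mult[OF fD(1)[of i] gD(1)[of "k - i"]]
    unfolding degree_add[OF that] psi_op_eq[OF r f] psi_op_eq[OF s g] .
  have fg: "f i \<otimes> g (k - i) \<in> I (2 * (q + t) + 2 * k * (p - 1))" if "i \<le> k" for i
    using filtration_mult[OF fD(1)[of i] gD(1)[of "k - i"]] unfolding degree_add[OF that] .
  have "psi_op k (q + t) (r \<otimes> s) = cl (2 * (q + t) + 2 * k * (p - 1)) (\<Oplus>i\<in>{..k}. f i \<otimes> g (k - i))"
    by (rule psi_op_eq[OF rs lax_formula_mult[OF r s f g]])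
  also have "\<dots> = (\<Oplus>\<^bsub>A\<^esub>i\<in>{..k}. cl (2 * (q + t) + 2 * k * (p - 1)) (f i \<otimes> g (k - i)))"
    by (rule class_finsum) (use fg in auto)
  also have "\<dots> = (\<Oplus>\<^bsub>A\<^esub>l\<in>{..k}. psi_op l q r \<otimes>\<^bsub>A\<^esub> psi_op (k - l) t s)"
    by (rule A.finsum_cong') (use prod psi_op_closed[OF r] psi_op_closed[OF s] in auto)
  finally show ?thesis .
qed

section \<open>Passage to classes and comparison with the prescribed values\<close>

lemma psi_operation_exists:
  obtains P where "P \<in> hom (add_monoid A) (add_monoid A)"
    and "\<And>q r. r \<in> I (2 * q) \<Longrightarrow> P (cl (2 * q) r) = psi_op i q r"
proof -
  \<comment> \<open>Zero is the only possible value in odd degrees, where all classes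
    vanish.\<close>
  define f where "f n r = (if even n then psi_op i (n div 2) r else \<zero>\<^bsub>A\<^esub>)" for n r
  have "f n \<in> hom ((add_monoid R)\<lparr>carrier := I n\<rparr>) (add_monoid A)" for n
    by (auto simp: f_def hom_def psi_op_closed psi_op_add elim!: evenE)
  moreover have "f n r = \<zero>\<^bsub>A\<^esub>" if "r \<in> I (Suc n)" for n r
  proof (cases "even n")
    case True
    then obtain q where n: "n = 2 * q" by (elim evenE)
    \<comment> \<open>The odd and the next even filtration coincide, so lying one step higher
      already means two.\<close>
    have "r \<in> I (2 * q + 2)"
      using that filtration_even[of "Suc q"] by (simp add: n)
    then show ?thesis by (simp add: f_def n psi_op_zero)
  qed (simp add: f_def)
  ultimately show thesis
  proof (rule gr_mod_universal)
    fix P assume "P \<in> hom (add_monoid A) (add_monoid A)" "\<And>n r. r \<in> I n \<Longrightarrow> P (cl n r) = f n r"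
    then show thesis
      using that[of P] by (simp add: f_def)
  qed
qed

lemma class_odd:
  assumes "odd n" "r \<in> I n"
  shows "cl n r = \<zero>\<^bsub>A\<^esub>"
proof (rule class_zero)
  obtain q where "n = 2 * q + 1" using assms(1) by (elim oddE)
  then show "r \<in> I (Suc n)"
    using assms(2) filtration_even[of "Suc q"] by simp
qed

text \<open>A value prescribed by any lift and any formula is thus a value of \<open>psi_op\<close>;
  for q = 0 the p-th power prescribed is the class of the top term.\<close>

lemma operation_value_imp_psi_op:
  assumes "operation_value p R I \<psi> i q x y"
  obtains r where "r \<in> I (2 * q)" "x = cl (2 * q) r" "y = psi_op i q r"
proof -
  obtain r where r: "r \<in> I (2 * q)" "x = cl (2 * q) r"
    and val: "if q = 0 then (\<exists>r'. atiyah_formula_zero p R \<psi> r r') \<and>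
          y = (if i = 0 then x [^]\<^bsub>A\<^esub> p else \<zero>\<^bsub>A\<^esub>)
        else (\<exists>f. atiyah_formula p R I \<psi> q r f \<and>
            y = (if i \<le> q then cl (2 * q + 2 * i * (p - 1)) (f i) else \<zero>\<^bsub>A\<^esub>))"
    using assms unfolding operation_value_def by blast
  have "y = psi_op i q r"
  proof (cases "q = 0")
    case True
    then show ?thesis
      using val r psi_op_top[OF r(1)] psi_op_above[OF r(1), of i] by auto
  next
    case False
    then show ?thesis
      using val psi_op_atiyah[OF r(1), of _ i] by auto
  qed
  with r show thesis by (rule that)
qed

text \<open>A lift in \<open>I (2 * q + 2)\<close> would have class zero, so every lift of a nonzero
  class is in filtration exactly 2q and is admissible.\<close>

lemma operation_value_psi_op:
  assumes r: "r \<in> I (2 * q)" and "cl (2 * q) r \<noteq> \<zero>\<^bsub>A\<^esub>"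
  shows "operation_value p R I \<psi> i q (cl (2 * q) r) (psi_op i q r)"
proof -
  have "r \<notin> I (2 * q + 2)"
    using assms(2) class_zero[of r "2 * q"] filtration_decreasing[of "Suc (2 * q)"] by auto
  moreover have "if q = 0 then (\<exists>r'. atiyah_formula_zero p R \<psi> r r') \<and>
          psi_op i q r = (if i = 0 then cl (2 * q) r [^]\<^bsub>A\<^esub> p else \<zero>\<^bsub>A\<^esub>)
        else (\<exists>f. atiyah_formula p R I \<psi> q r f \<and>
            psi_op i q r = (if i \<le> q then cl (2 * q + 2 * i * (p - 1)) (f i) else \<zero>\<^bsub>A\<^esub>))"
  proof (cases "q = 0")
    case True
    then show ?thesis
      using atiyah_zero[of r] r psi_op_top[OF r] psi_op_above[OF r, of i] by auto
  next
    case False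
    then obtain f where "atiyah_formula p R I \<psi> q r f" using atiyah_pos[of q r] r by auto
    then show ?thesis
      using False psi_op_atiyah[OF r, of f i] by auto
  qed
  ultimately show ?thesis
    unfolding operation_value_def using r by blast
qed

text \<open>Both sides are biadditive in x and y, which reduces the claim to homogeneous classes. In
  even degrees it is the product formula for elements; if one degree is odd, one factor is
  zero.\<close>

lemma cartan_formula:
  assumes hom: "\<And>i. P i \<in> hom (add_monoid A) (add_monoid A)"
    and P: "\<And>i q r. r \<in> I (2 * q) \<Longrightarrow> P i (cl (2 * q) r) = psi_op i q r"
    and x: "x \<in> carrier A" and y: "y \<in> carrier A"
  shows "P i (x \<otimes>\<^bsub>A\<^esub> y) = (\<Oplus>\<^bsub>A\<^esub>l\<in>{..i}. P l x \<otimes>\<^bsub>A\<^esub> P (i - l) y)"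
proof -
  have closed: "P j z \<in> carrier A" if "z \<in> carrier A" for j z
    using hom_in_carrier[OF hom] that by simp
  have P_add: "P j (z \<oplus>\<^bsub>A\<^esub> w) = P j z \<oplus>\<^bsub>A\<^esub> P j w" if "z \<in> carrier A" "w \<in> carrier A" for j z w
    using hom_mult[OF hom] that by simp
  have zero: "P j \<zero>\<^bsub>A\<^esub> = \<zero>\<^bsub>A\<^esub>" for j
    using P_add[of "\<zero>\<^bsub>A\<^esub>" "\<zero>\<^bsub>A\<^esub>" j] closed[of "\<zero>\<^bsub>A\<^esub>" j] by simp
  show ?thesis using x
  proof (induction x rule: gr_mod_induct)
    case (cl m r)
    show ?case using y
    proof (induction y rule: gr_mod_induct)
      case (cl n s)
      show ?case
      proof (cases "even m \<and> even n")
        case True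
        then obtain q t where mn: "m = 2 * q" "n = 2 * t" by (auto elim!: evenE)
        note rs = \<open>r \<in> I m\<close>[unfolded mn] \<open>s \<in> I n\<close>[unfolded mn]
        have "r \<otimes> s \<in> I (2 * (q + t))"
          using filtration_mult[OF rs] by (simp add: algebra_simps)
        then have "P i (cl (2 * q) r \<otimes>\<^bsub>A\<^esub> cl (2 * t) s) = psi_op i (q + t) (r \<otimes> s)"
          using P[of "r \<otimes> s" "q + t" i] rs by (simp add: class_mult algebra_simps)
        then show ?thesis
          unfolding mn P[OF rs(1)] P[OF rs(2)] psi_op_mult[OF rs] .
      next
        case False
        then have "cl m r = \<zero>\<^bsub>A\<^esub> \<or> cl n s = \<zero>\<^bsub>A\<^esub>"
          using class_odd \<open>r \<in> I m\<close> \<open>s \<in> I n\<close> by blast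
        then show ?thesis
          using closed class_closed[OF \<open>r \<in> I m\<close>] class_closed[OF \<open>s \<in> I n\<close>]
          by (auto simp: zero)
      qed
    next
      case (add y y')
      then show ?case
        using class_closed[OF cl] closed P_add
        by (simp add: A.r_distr A.finsum_addf Pi_def)
    qed
  next
    case (add x x')
    then show ?case
      using closed y P_add by (simp add: A.l_distr A.finsum_addf Pi_def)
  qed
qed

end

theorem theorem1p2:
  fixes R :: "('a, 'm) ring_scheme" and I :: "nat \<Rightarrow> 'a set" and p :: nat and \<psi> :: "'a \<Rightarrow> 'a"
    and A :: "'a gr_mod ring" and A_deg :: "nat \<Rightarrow> 'a gr_mod set"
  assumes "prime p"
    and "pre_psi_algebra R I p \<psi>"
  defines "A \<equiv> gr_mod_ring p R I"
    and "A_deg \<equiv> gr_mod_piece p R I"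
  shows "\<exists>P :: nat \<Rightarrow> 'a gr_mod \<Rightarrow> 'a gr_mod.
    (\<forall>i. P i \<in> carrier A \<rightarrow> carrier A) \<and>
    (\<forall>i n. P i \<in> A_deg n \<rightarrow> A_deg (n + 2 * i * (p - 1))) \<and>
    (\<forall>i q. \<forall>x \<in> A_deg (2 * q).
       (\<forall>y. operation_value p R I \<psi> i q x y \<longrightarrow> P i x = y) \<and>
       (x \<noteq> \<zero>\<^bsub>A\<^esub> \<longrightarrow> operation_value p R I \<psi> i q x (P i x))) \<and>
    (\<forall>i. \<forall>x \<in> carrier A. \<forall>y \<in> carrier A. P i (x \<oplus>\<^bsub>A\<^esub> y) = P i x \<oplus>\<^bsub>A\<^esub> P i y) \<and>
    (\<forall>q. \<forall>x \<in> A_deg (2 * q). P q x = x [^]\<^bsub>A\<^esub> p) \<and>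
    (\<forall>q. \<forall>x \<in> A_deg (2 * q). \<forall>i > q. P i x = \<zero>\<^bsub>A\<^esub>) \<and>
    (\<forall>i. \<forall>x \<in> carrier A. \<forall>y \<in> carrier A.
       P i (x \<otimes>\<^bsub>A\<^esub> y) = (\<Oplus>\<^bsub>A\<^esub>l\<in>{..i}. P l x \<otimes>\<^bsub>A\<^esub> P (i - l) y))"
proof -
  interpret pre_psi_algebra R I p \<psi> by fact
  interpret prime_psi_algebra R I p \<psi> by unfold_locales fact
  have "\<exists>P. P \<in> hom (add_monoid A) (add_monoid A) \<and>
      (\<forall>q. \<forall>r \<in> I (2 * q). P (gr_mod_class p R I (2 * q) r) = psi_op i q r)" for i
    unfolding A_def by (rule psi_operation_exists[of i]) auto
  then obtain P where P_hom: "\<And>i. P i \<in> hom (add_monoid A) (add_monoid A)"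
      and P: "\<And>i q r. r \<in> I (2 * q) \<Longrightarrow> P i (gr_mod_class p R I (2 * q) r) = psi_op i q r"
    by metis
  have zero: "P i \<zero>\<^bsub>A\<^esub> = \<zero>\<^bsub>A\<^esub>" for i
    using group_hom.hom_one[OF group_hom.intro[OF A.add.is_group A.add.is_group group_hom_axioms.intro]]
      P_hom[of i] by (simp add: A_def)
  have deg: "\<exists>r \<in> I n. x = gr_mod_class p R I n r" if "x \<in> A_deg n" for x n
    using that by (auto simp: A_deg_def gr_mod_piece_eq)
  show ?thesis
  proof (intro exI[of _ P] conjI allI ballI impI)
    show "P i \<in> carrier A \<rightarrow> carrier A" for i
      using P_hom[of i] by (simp add: hom_def)
    show "P i \<in> A_deg n \<rightarrow> A_deg (n + 2 * i * (p - 1))" for i n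
    proof
      fix x assume "x \<in> A_deg n"
      then obtain r where r: "r \<in> I n" "x = gr_mod_class p R I n r" using deg by blast
      show "P i x \<in> A_deg (n + 2 * i * (p - 1))"
      proof (cases "even n")
        case True
        then obtain q where "n = 2 * q" by (elim evenE)
        then show ?thesis
          using r P[of r q i] psi_op_in_piece[of r q i] by (simp add: A_deg_def)
      next
        case False
        then have "P i x = \<zero>\<^bsub>A\<^esub>"
          using r class_odd zero by (simp add: A_def)
        also have "\<zero>\<^bsub>A\<^esub> = gr_mod_class p R I (n + 2 * i * (p - 1)) \<zero>\<^bsub>R\<^esub>"
          unfolding A_def by (rule class_zero[symmetric]) (rule filtration_closed)
        also have "\<dots> \<in> A_deg (n + 2 * i * (p - 1))"
          unfolding A_deg_def gr_mod_piece_eq by (rule imageI) (rule filtration_closed)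
        finally show ?thesis .
      qed
    qed
  next
    \<comment> \<open>The prescribed value is \<open>psi_op\<close> of some lift, and
      \<open>P i\<close> takes on x the value given by each of its lifts.\<close>
    fix i q x y assume "operation_value p R I \<psi> i q x y"
    then show "P i x = y"
      by (rule operation_value_imp_psi_op) (simp add: P)
  next
    fix i q x assume x: "x \<in> A_deg (2 * q)" "x \<noteq> \<zero>\<^bsub>A\<^esub>"
    then obtain r where "r \<in> I (2 * q)" "x = gr_mod_class p R I (2 * q) r" using deg by blast
    then show "operation_value p R I \<psi> i q x (P i x)"
      using x(2) P[of r q i] operation_value_psi_op[of r q i] by (simp add: A_def)
  next
    fix i x y assume "x \<in> carrier A" "y \<in> carrier A"
    then show "P i (x \<oplus>\<^bsub>A\<^esub> y) = P i x \<oplus>\<^bsub>A\<^esub> P i y"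
      using hom_mult[OF P_hom] by simp
    show "P i (x \<otimes>\<^bsub>A\<^esub> y) = (\<Oplus>\<^bsub>A\<^esub>l\<in>{..i}. P l x \<otimes>\<^bsub>A\<^esub> P (i - l) y)"
      using cartan_formula[of P x y i] P_hom P \<open>x \<in> carrier A\<close> \<open>y \<in> carrier A\<close> unfolding A_def by blast
  next
    fix q x assume "x \<in> A_deg (2 * q)"
    then obtain r where r: "r \<in> I (2 * q)" "x = gr_mod_class p R I (2 * q) r" using deg by blast
    then show "P q x = x [^]\<^bsub>A\<^esub> p"
      using P psi_op_top unfolding A_def by simp
    fix i assume "q < i"
    then show "P i x = \<zero>\<^bsub>A\<^esub>"
      using r P psi_op_above unfolding A_def by simp
  qed
qed

end
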